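(* Let $f$ be a continuous real function on $(0,\infty)$. Then $f$ being operator monotone is equivalent to each of the following conditions: (1) $f(A\,\triangledown\,B)\ge f(A\,\sigma\,B)$ for all $A,B\in B(\mathcal{H})^{++}$ and for some symmetric operator mean $\sigma\ne\triangledown$; (2) $f(A\,!\,B)\le f(A\,\sigma\,B)$ for all $A,B\in B(\mathcal{H})^{++}$ and for some symmetric operator mean $\sigma\ne\,!$. Moreover, $f$ being operator monotone decreasing is equivalent to each of (1) and (2) with the inequality reversed, that is, to each of: (1') $f(A\,\triangledown\,B)\le f(A\,\sigma\,B)$ for all $A,B\in B(\mathcal{H})^{++}$ and for some symmetric operator mean $\sigma\ne\triangledown$; (2') $f(A\,!\,B)\ge f(A\,\sigma\,B)$ for all $A,B\in B(\mathcal{H})^{++}$ and for some symmetric operator mean $\sigma\ne\,!$.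
   Context: $\mathcal{H}$ is an infinite-dimensional separable Hilbert space, and $B(\mathcal{H})^{++}$ is the set of positive (i.e. positive semidefinite) invertible bounded operators on $\mathcal{H}$. $f(A)$ is defined by continuous functional calculus. A continuous real function $f$ on $(0,\infty)$ is operator monotone if $A\ge B$ implies $f(A)\ge f(B)$ for $A,B\in B(\mathcal{H})^{++}$, and operator monotone decreasing if $-f$ is operator monotone. Operator means (Kubo–Ando): to each nonnegative (continuous) operator monotone function $h$ on $[0,\infty)$ with $h(1)=1$ corresponds the operator mean $\sigma=\sigma_h$ given by $A\,\sigma\,B:=A^{1/2}h(A^{-1/2}BA^{-1/2})A^{1/2}$ for $A,B\in B(\mathcal{H})^{++}$. An operator mean $\sigma$ is symmetric if $A\,\sigma\,B=B\,\sigma\,A$ for all $A,B\in B(\mathcal{H})^{++}$. The arithmetic mean is $A\,\triangledown\,B:=(A+B)/2$ and the harmonic mean is $A\,!\,B:=\bigl((A^{-1}+B^{-1})/2\bigr)^{-1}$ for $A,B\in B(\mathcal{H})^{++}$. *)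

theory Defs
  imports "HOL-Analysis.Analysis" "HOL-Computational_Algebra.Polynomial"
begin

section \<open>Complex Hilbert spaces\<close>

text \<open>The inner product \<open>cinner\<close> is conjugate-linear in its first and linear in its second
  argument.  The real part of \<open>cinner\<close> is the inner product of the underlying real Hilbert space,
  so that \<open>norm x = sqrt (Re (cinner x x))\<close>, and definiteness comes from \<open>real_inner\<close>.\<close>

class complex_hilbert_space = real_inner + banach +
  fixes scaleC :: "complex \<Rightarrow> 'a \<Rightarrow> 'a"  (infixr \<open>*\<^sub>C\<close> 75)
    and cinner :: "'a \<Rightarrow> 'a \<Rightarrow> complex"
  assumes scaleC_add_right: "c *\<^sub>C (x + y) = c *\<^sub>C x + c *\<^sub>C y"
    and scaleC_add_left: "(c + d) *\<^sub>C x = c *\<^sub>C x + d *\<^sub>C x"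
    and scaleC_scaleC: "c *\<^sub>C d *\<^sub>C x = (c * d) *\<^sub>C x"
    and scaleC_of_real: "complex_of_real r *\<^sub>C x = r *\<^sub>R x"
    and cinner_add_right: "cinner x (y + z) = cinner x y + cinner x z"
    and cinner_scaleC_right: "cinner x (c *\<^sub>C y) = c * cinner x y"
    and cinner_commute: "cinner x y = cnj (cinner y x)"
    and Re_cinner: "Re (cinner x y) = inner x y"

global_interpretation complex_vector: vector_space
  "scaleC :: complex \<Rightarrow> 'a \<Rightarrow> 'a::complex_hilbert_space"
  by unfold_locales
    (use scaleC_add_right scaleC_add_left scaleC_scaleC scaleC_of_real[of 1] in auto)

definition infinite_dimensional :: "'a::complex_hilbert_space itself \<Rightarrow> bool" where
  "infinite_dimensional _ \<longleftrightarrow> \<not> (\<exists>B :: 'a set. finite B \<and> complex_vector.span B = UNIV)"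

lemma norm_scaleC: "norm (c *\<^sub>C x) = cmod c * norm (x :: 'a::complex_hilbert_space)"
proof -
  have real: "cinner x x = complex_of_real (inner x x)"
    by (metis Re_cinner cinner_commute Reals_cnj_iff of_real_Re)
  have "cinner (c *\<^sub>C x) (c *\<^sub>C x) = c * cnj (c * cinner x x)"
    by (metis cinner_commute cinner_scaleC_right)
  also have "\<dots> = complex_of_real ((cmod c)\<^sup>2 * inner x x)"
    using complex_norm_square[of c] by (simp add: real)
  finally have "inner (c *\<^sub>C x) (c *\<^sub>C x) = (cmod c)\<^sup>2 * inner x x"
    by (metis Re_cinner Re_complex_of_real)
  then show ?thesis
    by (simp add: norm_eq_sqrt_inner real_sqrt_mult)
qed

lift_definition scalar_op :: "complex \<Rightarrow> 'a \<Rightarrow>\<^sub>L 'a::complex_hilbert_space" is scaleC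
proof (rule bounded_linear_intro)
  fix c r and x y :: 'a
  show "c *\<^sub>C (x + y) = c *\<^sub>C x + c *\<^sub>C y" by (rule scaleC_add_right)
  show "c *\<^sub>C r *\<^sub>R x = r *\<^sub>R c *\<^sub>C x"
    by (metis scaleC_of_real scaleC_scaleC mult.commute)
  show "norm (c *\<^sub>C x) \<le> norm x * cmod c" by (simp add: norm_scaleC)
qed


section \<open>Bounded operators\<close>

text \<open>\<open>B(H)\<close> is the set of complex-linear elements of the type of bounded real-linear maps; the
  operator norm does not depend on the scalar field.\<close>

definition bounded_ops :: "('a::complex_hilbert_space \<Rightarrow>\<^sub>L 'a) set" where
  "bounded_ops = {A :: 'a \<Rightarrow>\<^sub>L 'a. \<forall>c x. blinfun_apply A (c *\<^sub>C x) = c *\<^sub>C blinfun_apply A x}"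

definition inverse_of :: "('a::complex_hilbert_space \<Rightarrow>\<^sub>L 'a) \<Rightarrow> ('a \<Rightarrow>\<^sub>L 'a) \<Rightarrow> bool" where
  "inverse_of A B \<longleftrightarrow>
     B \<in> bounded_ops \<and> A o\<^sub>L B = id_blinfun \<and> B o\<^sub>L A = id_blinfun"

definition op_invertible :: "('a::complex_hilbert_space \<Rightarrow>\<^sub>L 'a) \<Rightarrow> bool" where
  "op_invertible A \<longleftrightarrow> (\<exists>B. inverse_of A B)"

definition op_inverse :: "('a::complex_hilbert_space \<Rightarrow>\<^sub>L 'a) \<Rightarrow> ('a \<Rightarrow>\<^sub>L 'a)" where
  "op_inverse A = (THE B. inverse_of A B)"

definition positive_ops :: "('a::complex_hilbert_space \<Rightarrow>\<^sub>L 'a) set" where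
  "positive_ops = {A \<in> bounded_ops. \<forall>x. cinner x (blinfun_apply A x) \<in> \<real>\<^sub>\<ge>\<^sub>0}"

definition positive_invertible_ops :: "('a::complex_hilbert_space \<Rightarrow>\<^sub>L 'a) set" where
  "positive_invertible_ops = {A \<in> positive_ops. op_invertible A}"

definition loewner_le :: "('a::complex_hilbert_space \<Rightarrow>\<^sub>L 'a) \<Rightarrow> ('a \<Rightarrow>\<^sub>L 'a) \<Rightarrow> bool"
    (infix \<open>\<preceq>\<close> 50) where
  "A \<preceq> B \<longleftrightarrow> B - A \<in> positive_ops"

definition op_spectrum :: "('a::complex_hilbert_space \<Rightarrow>\<^sub>L 'a) \<Rightarrow> complex set" where
  "op_spectrum A = {z. \<not> op_invertible (A - scalar_op z)}"


section \<open>Continuous functional calculus\<close>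

definition op_poly ::
    "real poly \<Rightarrow> ('a::complex_hilbert_space \<Rightarrow>\<^sub>L 'a) \<Rightarrow> ('a \<Rightarrow>\<^sub>L 'a)" where
  "op_poly p A = (\<Sum>i\<le>degree p. coeff p i *\<^sub>R (((o\<^sub>L) A ^^ i) id_blinfun))"

text \<open>For a self-adjoint operator \<open>A\<close> (whose spectrum is a compact set of reals) and a real
  function \<open>f\<close> continuous on the spectrum, \<open>f(A)\<close> is the norm limit of \<open>p\<^sub>n(A)\<close> for any real
  polynomials \<open>p\<^sub>n\<close> converging to \<open>f\<close> uniformly on the spectrum.  Such polynomials exist by
  Weierstrass' theorem, and the limit exists and does not depend on their choice since
  \<open>p(A)\<close> has norm \<open>max \<bar>p\<bar>\<close>, taken over the spectrum.\<close>

definition op_fun ::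
    "(real \<Rightarrow> real) \<Rightarrow> ('a::complex_hilbert_space \<Rightarrow>\<^sub>L 'a) \<Rightarrow> ('a \<Rightarrow>\<^sub>L 'a)" where
  "op_fun f A = (THE T. \<exists>p :: nat \<Rightarrow> real poly.
     uniform_limit {x. complex_of_real x \<in> op_spectrum A} (\<lambda>n. poly (p n)) f sequentially \<and>
     (\<lambda>n. op_poly (p n) A) \<longlonglongrightarrow> T)"


section \<open>Operator monotone functions\<close>

text \<open>The Hilbert space enters these notions only through its type.\<close>

definition operator_monotone :: "'a::complex_hilbert_space itself \<Rightarrow> (real \<Rightarrow> real) \<Rightarrow> bool" where
  "operator_monotone _ f \<longleftrightarrow> continuous_on {0<..} f \<and>
     (\<forall>A \<in> positive_invertible_ops. \<forall>B \<in> (positive_invertible_ops :: ('a \<Rightarrow>\<^sub>L 'a) set).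
        B \<preceq> A \<longrightarrow> op_fun f B \<preceq> op_fun f A)"

definition operator_monotone_decreasing ::
    "'a::complex_hilbert_space itself \<Rightarrow> (real \<Rightarrow> real) \<Rightarrow> bool" where
  "operator_monotone_decreasing T f \<longleftrightarrow> operator_monotone T (\<lambda>x. - f x)"

text \<open>The version for functions on the closed half-line, where \<open>A\<close> and \<open>B\<close> need not be
  invertible.\<close>

definition operator_monotone_closed ::
    "'a::complex_hilbert_space itself \<Rightarrow> (real \<Rightarrow> real) \<Rightarrow> bool" where
  "operator_monotone_closed _ h \<longleftrightarrow> continuous_on {0..} h \<and>
     (\<forall>A \<in> positive_ops. \<forall>B \<in> (positive_ops :: ('a \<Rightarrow>\<^sub>L 'a) set).
        B \<preceq> A \<longrightarrow> op_fun h B \<preceq> op_fun h A)"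


section \<open>Operator means\<close>

type_synonym 'a binop = "('a \<Rightarrow>\<^sub>L 'a) \<Rightarrow> ('a \<Rightarrow>\<^sub>L 'a) \<Rightarrow> ('a \<Rightarrow>\<^sub>L 'a)"

definition kubo_ando :: "(real \<Rightarrow> real) \<Rightarrow> 'a::complex_hilbert_space binop" where
  "kubo_ando h A B =
     (let R = op_fun sqrt A; S = op_inverse R in R o\<^sub>L op_fun h (S o\<^sub>L B o\<^sub>L S) o\<^sub>L R)"

text \<open>Operator means are operations on the positive invertible operators; values of a \<open>binop\<close>
  at other arguments are irrelevant here and in the two notions below.\<close>

definition operator_mean :: "'a::complex_hilbert_space binop \<Rightarrow> bool" where
  "operator_mean \<sigma> \<longleftrightarrow>
     (\<exists>h. operator_monotone_closed TYPE('a) h \<and> (\<forall>t\<ge>0. h t \<ge> 0) \<and> h 1 = 1 \<and>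
        (\<forall>A \<in> positive_invertible_ops. \<forall>B \<in> positive_invertible_ops. \<sigma> A B = kubo_ando h A B))"

definition symmetric_mean :: "'a::complex_hilbert_space binop \<Rightarrow> bool" where
  "symmetric_mean \<sigma> \<longleftrightarrow> operator_mean \<sigma> \<and>
     (\<forall>A \<in> positive_invertible_ops. \<forall>B \<in> positive_invertible_ops. \<sigma> A B = \<sigma> B A)"

definition distinct_means ::
    "'a::complex_hilbert_space binop \<Rightarrow> 'a binop \<Rightarrow> bool" where
  "distinct_means \<sigma> \<tau> \<longleftrightarrow>
     (\<exists>A \<in> positive_invertible_ops. \<exists>B \<in> positive_invertible_ops. \<sigma> A B \<noteq> \<tau> A B)"

definition arithmetic_mean :: "'a::complex_hilbert_space binop" where
  "arithmetic_mean A B = (1 / 2) *\<^sub>R (A + B)"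

definition harmonic_mean :: "'a::complex_hilbert_space binop" where
  "harmonic_mean A B = op_inverse ((1 / 2) *\<^sub>R (op_inverse A + op_inverse B))"

end

theory Submission
  imports Defs "HOL-Computational_Algebra.Fundamental_Theorem_Algebra"
begin

text \<open>If \<open>f\<close> is operator monotone, then \<open>f(A ! B) \<le> f((A + B)/2)\<close>, because the harmonic mean lies below the
  arithmetic mean.  Each of these two symmetric means serves as \<open>\<sigma>\<close> in the condition that involves the
  other one.

  The converse rests on the fact that operators \<open>B \<le> A\<close> that are close to each other are the two means of
  a common pair.  Let \<open>\<sigma>\<close> be the symmetric mean of \<open>h\<close>, different from the arithmetic mean.  An operator
  monotone function is concave (\<open>operator_monotone_concave\<close>), so the numerical mean
  \<open>k(z) = (1 - z) \<sigma> (1 + z) = (1 - z) h((1 + z)/(1 - z))\<close> is an even concave function, not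
  constant, with maximum \<open>k(0) = 1\<close>.  It therefore takes all values in some interval \<open>[c, 1]\<close>, \<open>c < 1\<close>,
  and has a continuous section \<open>\<zeta>\<close> there (\<open>mean_section\<close>).  If \<open>cA \<le> B \<le> A\<close>, then
  \<open>T = A\<^sup>-\<^sup>1\<^sup>/\<^sup>2 B A\<^sup>-\<^sup>1\<^sup>/\<^sup>2\<close> has its spectrum in \<open>[c, 1]\<close>, and \<open>A\<close> and \<open>B\<close> are the arithmetic mean and the
  \<open>\<sigma>\<close>-mean of \<open>A\<^sup>1\<^sup>/\<^sup>2 (1 \<mp> \<zeta>(T)) A\<^sup>1\<^sup>/\<^sup>2\<close> (\<open>common_pair_of_nearby_operators\<close>).  The hypothesis gives
  \<open>f(B) \<le> f(A)\<close> for such pairs, and a subdivision of the segment from \<open>B\<close> to \<open>A\<close> gives it for all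
  \<open>B \<le> A\<close> (\<open>monotone_of_monotone_nearby\<close>).

  The condition on the harmonic mean becomes the one on the arithmetic mean under \<open>A \<mapsto> A\<^sup>-\<^sup>1\<close>, with \<open>f\<close>
  replaced by \<open>- f(1/x)\<close> and \<open>h\<close> by \<open>1 / h(1/t)\<close>; the decreasing case is the increasing one for \<open>- f\<close>.

  The functional calculus behind these steps is developed from the fact that a real polynomial of a
  self-adjoint operator is bounded below by its minimum on the spectrum (\<open>op_poly_lower_bound\<close>).  Means
  are computed in a normal form (\<open>kubo_ando_congruence\<close>): for \<open>A = R p(T) R\<close> and \<open>B = R q(T) R\<close> the
  mean of \<open>h\<close> is \<open>R (p h(q/p))(T) R\<close>.\<close>


section \<open>Self-adjoint operators as real symmetric operators\<close>

lemma cinner_scaleC_left: "cinner (c *\<^sub>C x) y = cnj c * cinner x (y :: 'a::complex_hilbert_space)"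
  by (metis cinner_commute cinner_scaleC_right complex_cnj_mult)

lemma cinner_add_left:
  "cinner (x + y) z = cinner x z + cinner y (z :: 'a::complex_hilbert_space)"
  by (metis cinner_commute cinner_add_right complex_cnj_add)

lemma Im_cinner: "Im (cinner x y) = - (x \<bullet> (\<i> *\<^sub>C (y :: 'a::complex_hilbert_space)))"
  by (metis Re_cinner Re_i_times cinner_scaleC_right add.inverse_inverse)

lemma cinner_self: "cinner x x = complex_of_real (x \<bullet> (x :: 'a::complex_hilbert_space))"
  by (metis Re_cinner cinner_commute Reals_cnj_iff of_real_Re)

lemma bounded_opsI [intro]:
  fixes A :: "'a::complex_hilbert_space \<Rightarrow>\<^sub>L 'a"
  assumes "\<And>c x. A (c *\<^sub>C x) = c *\<^sub>C A x"
  shows "A \<in> bounded_ops"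
  using assms by (simp add: bounded_ops_def)

lemma bounded_ops_scaleC: "A \<in> bounded_ops \<Longrightarrow> A (c *\<^sub>C x) = c *\<^sub>C A x"
  by (simp add: bounded_ops_def)

lemma scaleC_scaleR: "c *\<^sub>C r *\<^sub>R x = r *\<^sub>R c *\<^sub>C (x :: 'a::complex_hilbert_space)"
  by (metis scaleC_of_real scaleC_scaleC mult.commute)

lemma bounded_ops_add: "A \<in> bounded_ops \<Longrightarrow> B \<in> bounded_ops \<Longrightarrow> A + B \<in> bounded_ops"
  by (auto simp: bounded_ops_def blinfun.bilinear_simps scaleC_add_right)

lemma bounded_ops_scaleR: "A \<in> bounded_ops \<Longrightarrow> r *\<^sub>R A \<in> bounded_ops"
  by (auto simp: bounded_ops_def blinfun.bilinear_simps scaleC_scaleR)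

lemma bounded_ops_diff: "A \<in> bounded_ops \<Longrightarrow> B \<in> bounded_ops \<Longrightarrow> A - B \<in> bounded_ops"
  using bounded_ops_add[of A "(-1) *\<^sub>R B"] bounded_ops_scaleR[of B "-1"] by simp

lemma bounded_ops_id [simp]: "id_blinfun \<in> bounded_ops"
  by auto

lemma bounded_ops_compose: "A \<in> bounded_ops \<Longrightarrow> B \<in> bounded_ops \<Longrightarrow> A o\<^sub>L B \<in> bounded_ops"
  by (auto simp: bounded_ops_def)

lemma continuous_scaleC: "continuous_on UNIV (\<lambda>x :: 'a::complex_hilbert_space. c *\<^sub>C x)"
  using linear_continuous_on[OF blinfun.bounded_linear_right, of UNIV "scalar_op c"]
  by (simp add: scalar_op.rep_eq)

text \<open>Positivity in \<open>B(H)\<close> refers to the complex inner product.  For the rest of the argument only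
  the underlying real Hilbert space matters: a complex-linear operator is self-adjoint iff it is
  symmetric for the real part of the inner product.\<close>

definition self_adjoint :: "('a::complex_hilbert_space \<Rightarrow>\<^sub>L 'a) \<Rightarrow> bool" where
  "self_adjoint A \<longleftrightarrow> A \<in> bounded_ops \<and> (\<forall>x y. x \<bullet> A y = A x \<bullet> y)"

lemma self_adjointD: "self_adjoint A \<Longrightarrow> x \<bullet> A y = A x \<bullet> y"
  by (simp add: self_adjoint_def)

lemma self_adjoint_bounded: "self_adjoint A \<Longrightarrow> A \<in> bounded_ops"
  by (simp add: self_adjoint_def)

lemma self_adjoint_id [simp]: "self_adjoint id_blinfun"
  by (simp add: self_adjoint_def)

lemma self_adjoint_add: "self_adjoint A \<Longrightarrow> self_adjoint B \<Longrightarrow> self_adjoint (A + B)"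
  by (simp add: self_adjoint_def bounded_ops_add blinfun.bilinear_simps inner_simps)

lemma self_adjoint_scaleR: "self_adjoint A \<Longrightarrow> self_adjoint (r *\<^sub>R A)"
  by (simp add: self_adjoint_def bounded_ops_scaleR blinfun.bilinear_simps)

lemma self_adjoint_diff: "self_adjoint A \<Longrightarrow> self_adjoint B \<Longrightarrow> self_adjoint (A - B)"
  by (simp add: self_adjoint_def bounded_ops_diff blinfun.bilinear_simps inner_simps)

lemma self_adjoint_congruence:
  "self_adjoint R \<Longrightarrow> self_adjoint A \<Longrightarrow> self_adjoint (R o\<^sub>L A o\<^sub>L R)"
  by (simp add: self_adjoint_def bounded_ops_compose)

lemma self_adjoint_compose:
  assumes "self_adjoint A" "self_adjoint B" "A o\<^sub>L B = B o\<^sub>L A"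
  shows "self_adjoint (A o\<^sub>L B)"
  using assms by (metis bounded_ops_compose blinfun_apply_blinfun_compose self_adjoint_def)

lemma self_adjoint_limit:
  assumes "\<And>n. self_adjoint (X n)" "X \<longlonglongrightarrow> A"
  shows "self_adjoint A"
proof -
  have lim: "(\<lambda>n. X n x) \<longlonglongrightarrow> A x" for x
    using assms(2) by (intro tendsto_intros)
  have "A (c *\<^sub>C x) = c *\<^sub>C A x" for c x
  proof -
    have "(\<lambda>n. c *\<^sub>C X n x) \<longlonglongrightarrow> c *\<^sub>C A x"
      using continuous_on_tendsto_compose[OF continuous_scaleC lim] by simp
    then have "(\<lambda>n. X n (c *\<^sub>C x)) \<longlonglongrightarrow> c *\<^sub>C A x"
      using assms(1) by (simp add: bounded_ops_scaleC self_adjoint_bounded)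
    with lim show ?thesis
      by (rule LIMSEQ_unique)
  qed
  moreover have "x \<bullet> A y = A x \<bullet> y" for x y
  proof (rule LIMSEQ_unique)
    show "(\<lambda>n. x \<bullet> X n y) \<longlonglongrightarrow> x \<bullet> A y"
      by (rule tendsto_inner[OF tendsto_const lim])
    have "(\<lambda>n. X n x \<bullet> y) \<longlonglongrightarrow> A x \<bullet> y"
      by (rule tendsto_inner[OF lim tendsto_const])
    then show "(\<lambda>n. x \<bullet> X n y) \<longlonglongrightarrow> A x \<bullet> y"
      using assms(1) by (simp add: self_adjointD)
  qed
  ultimately show ?thesis
    by (auto simp: self_adjoint_def)
qed

text \<open>Polarization: if \<open>\<langle>x, Ax\<rangle>\<close> is real for all \<open>x\<close>, then its imaginary part at \<open>x + iy\<close> shows that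
  \<open>\<langle>x, Ay\<rangle>\<close> and \<open>\<langle>y, Ax\<rangle>\<close> have the same real part.\<close>

lemma positive_ops_iff:
  "A \<in> positive_ops \<longleftrightarrow> self_adjoint A \<and> (\<forall>x. 0 \<le> x \<bullet> A x)"
proof
  assume A: "A \<in> positive_ops"
  then have bdd: "A \<in> bounded_ops" and real: "Im (cinner x (A x)) = 0"
    and nonneg: "0 \<le> x \<bullet> A x" for x
    by (auto simp: positive_ops_def complex_nonneg_Reals_iff simp flip: Re_cinner)
  have "x \<bullet> A y = A x \<bullet> y" for x y
  proof -
    have "Im (cinner (x + \<i> *\<^sub>C y) (A (x + \<i> *\<^sub>C y))) = 0"
      by (rule real)
    then have "Im (\<i> * cinner x (A y) - \<i> * cinner y (A x)) = 0"
      using real[of x] real[of y] bounded_ops_scaleC[OF bdd]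
      by (simp add: blinfun.bilinear_simps cinner_add_left cinner_add_right
          cinner_scaleC_left cinner_scaleC_right)
    then show ?thesis
      by (simp add: Re_cinner inner_commute)
  qed
  then show "self_adjoint A \<and> (\<forall>x. 0 \<le> x \<bullet> A x)"
    using bdd nonneg by (simp add: self_adjoint_def)
next
  assume A: "self_adjoint A \<and> (\<forall>x. 0 \<le> x \<bullet> A x)"
  have "Im (cinner x (A x)) = Im (cinner (A x) x)" for x
    using A by (metis Im_cinner bounded_ops_scaleC self_adjointD self_adjoint_bounded)
  moreover have "Im (cinner (A x) x) = - Im (cinner x (A x))" for x
    by (subst cinner_commute) simp
  ultimately have "Im (cinner x (A x)) = 0" for x
    by (metis add.inverse_inverse neg_equal_zero)
  then show "A \<in> positive_ops"
    using A by (auto simp: positive_ops_def complex_nonneg_Reals_iff Re_cinner self_adjoint_bounded)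
qed

lemma loewner_le_iff:
  assumes "self_adjoint A" "self_adjoint B"
  shows "A \<preceq> B \<longleftrightarrow> (\<forall>x. x \<bullet> A x \<le> x \<bullet> B x)"
  using assms
  by (simp add: loewner_le_def positive_ops_iff self_adjoint_diff blinfun.bilinear_simps inner_simps)

text \<open>The Cauchy--Schwarz inequality for the form \<open>\<langle>x, Ay\<rangle>\<close>, taken at \<open>y = Ax\<close>; it comes from
  \<open>\<langle>x - tAx, A(x - tAx)\<rangle> \<ge> 0\<close> with \<open>t = 1/(\<parallel>A\<parallel> + 1)\<close>, where adding \<open>1\<close> avoids the case \<open>A = 0\<close>.\<close>

lemma positive_norm_square_le:
  assumes "self_adjoint A" and pos: "\<And>x. 0 \<le> x \<bullet> A x"
  shows "(norm (A x))\<^sup>2 \<le> (norm A + 1) * (x \<bullet> A x)"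
proof -
  define t where "t = 1 / (norm A + 1)"
  have t: "t > 0" "t * norm A \<le> 1"
    by (auto simp: t_def divide_simps add_nonneg_pos)
  have "A x \<bullet> A (A x) \<le> norm A * (norm (A x))\<^sup>2"
    using norm_cauchy_schwarz[of "A x" "A (A x)"] norm_blinfun[of A "A x"]
      mult_left_mono[OF norm_blinfun[of A "A x"], of "norm (A x)"]
    by (simp add: power2_eq_square algebra_simps)
  then have "t\<^sup>2 * (A x \<bullet> A (A x)) \<le> t * (t * norm A) * (norm (A x))\<^sup>2"
    using t by (simp add: power2_eq_square mult.assoc mult_left_mono)
  also have "\<dots> \<le> t * (norm (A x))\<^sup>2"
    using t by (intro mult_right_mono mult_left_le) auto
  finally have sq: "t\<^sup>2 * (A x \<bullet> A (A x)) \<le> t * (norm (A x))\<^sup>2" .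
  have "0 \<le> (x - t *\<^sub>R A x) \<bullet> A (x - t *\<^sub>R A x)"
    by (rule pos)
  also have "\<dots> = x \<bullet> A x - 2 * t * (norm (A x))\<^sup>2 + t\<^sup>2 * (A x \<bullet> A (A x))"
    using assms(1)
    by (simp add: blinfun.bilinear_simps inner_simps self_adjointD power2_norm_eq_inner)
      (simp add: power2_eq_square algebra_simps)
  finally have "t * (norm (A x))\<^sup>2 \<le> x \<bullet> A x"
    using sq by linarith
  then show ?thesis
    by (simp add: t_def divide_simps mult.commute add_nonneg_pos split: if_splits)
qed


section \<open>Invertibility\<close>

lemma op_inverse_eqI:
  assumes "B \<in> bounded_ops" "A o\<^sub>L B = id_blinfun" "B o\<^sub>L A = id_blinfun"
  shows "op_inverse A = B"
  unfolding op_inverse_def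
proof (rule the_equality)
  show "inverse_of A B"
    using assms by (simp add: inverse_of_def)
  fix C assume "inverse_of A C"
  then have "C = C o\<^sub>L (A o\<^sub>L B)" "C o\<^sub>L A = id_blinfun"
    using assms(2) by (auto simp: inverse_of_def intro!: blinfun_eqI)
  then show "C = B"
    by (metis blinfun_apply_blinfun_compose blinfun_apply_id_blinfun blinfun_eqI)
qed

lemma inverse_of_op_inverse: "op_invertible A \<Longrightarrow> inverse_of A (op_inverse A)"
  by (metis inverse_of_def op_inverse_eqI op_invertible_def)

lemma op_inverse_right: "op_invertible A \<Longrightarrow> A (op_inverse A x) = x"
  and op_inverse_left: "op_invertible A \<Longrightarrow> op_inverse A (A x) = x"
  and op_inverse_bounded: "op_invertible A \<Longrightarrow> op_inverse A \<in> bounded_ops"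
  using inverse_of_op_inverse[of A]
  by (metis inverse_of_def blinfun_apply_blinfun_compose blinfun_apply_id_blinfun)+

lemma op_invertibleI:
  assumes "B \<in> bounded_ops" "A o\<^sub>L B = id_blinfun" "B o\<^sub>L A = id_blinfun"
  shows "op_invertible A"
  using assms by (auto simp: op_invertible_def inverse_of_def)

lemma op_invertible_compose:
  assumes "op_invertible A" "op_invertible B"
  shows "op_invertible (A o\<^sub>L B)"
  by (rule op_invertibleI[of "op_inverse B o\<^sub>L op_inverse A"])
    (use assms in \<open>auto simp: bounded_ops_compose op_inverse_bounded op_inverse_left op_inverse_right
      intro!: blinfun_eqI\<close>)

lemma op_invertible_scaleR_id: "r \<noteq> 0 \<Longrightarrow> op_invertible (r *\<^sub>R id_blinfun)"
  by (rule op_invertibleI[of "(1 / r) *\<^sub>R id_blinfun"])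
    (auto simp: bounded_ops_scaleR blinfun.bilinear_simps intro!: blinfun_eqI)

text \<open>An operator \<open>A \<ge> c > 0\<close> is onto because \<open>x \<mapsto> x - t(Ax - y)\<close> is a contraction for small \<open>t\<close>; its
  fixed point solves \<open>Ax = y\<close>.  The choice \<open>t = c/K\<^sup>2\<close> with \<open>K \<ge> \<parallel>A\<parallel>\<close> gives the contraction constant
  \<open>(1 - c\<^sup>2/K\<^sup>2)\<^sup>1\<^sup>/\<^sup>2\<close>.\<close>

lemma bounded_below_imp_invertible:
  fixes A :: "'a::complex_hilbert_space \<Rightarrow>\<^sub>L 'a"
  assumes A: "self_adjoint A" and c: "c > 0" and below: "\<And>x. c * (x \<bullet> x) \<le> x \<bullet> A x"
  shows "op_invertible A"
proof -
  have le: "c * norm x \<le> norm (A x)" for x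
  proof (cases "x = 0")
    case False
    have "c * norm x * norm x \<le> norm (A x) * norm x"
      using below[of x] norm_cauchy_schwarz[of x "A x"]
      by (simp add: dot_square_norm power2_eq_square algebra_simps)
    then show ?thesis using False by simp
  qed simp
  define K where "K = norm A + c"
  have K: "K > 0" "norm (A x) \<le> K * norm x" for x
    using c norm_blinfun[of A x] mult_nonneg_nonneg[of c "norm x"]
    by (auto simp: K_def distrib_right add_nonneg_pos intro: add_increasing2)
  have cK: "c\<^sup>2 \<le> K\<^sup>2" "0 < c\<^sup>2"
    using c by (auto simp: K_def)
  define q where "q = 1 - c\<^sup>2 / K\<^sup>2"
  have q: "0 \<le> q" "q < 1"
    using cK K(1) by (auto simp: q_def divide_simps)
  define t where "t = c / K\<^sup>2"
  have contr: "norm (x - t *\<^sub>R A x) \<le> sqrt q * norm x" for x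
  proof -
    have "(norm (x - t *\<^sub>R A x))\<^sup>2 = (norm x)\<^sup>2 - 2 * t * (x \<bullet> A x) + t\<^sup>2 * (norm (A x))\<^sup>2"
      by (simp add: power2_norm_eq_inner inner_simps inner_commute)
        (simp add: power2_eq_square algebra_simps)
    also have "\<dots> \<le> (norm x)\<^sup>2 - 2 * t * (c * (norm x)\<^sup>2) + t\<^sup>2 * (K * norm x)\<^sup>2"
      using below[of x] K(2)[of x] c K(1)
      by (intro add_mono diff_mono mult_left_mono power_mono)
        (auto simp: t_def power2_norm_eq_inner)
    also have "\<dots> = q * (norm x)\<^sup>2"
      using K(1) by (simp add: t_def q_def power_mult_distrib field_simps power2_eq_square)
    finally have "(norm (x - t *\<^sub>R A x))\<^sup>2 \<le> (sqrt q * norm x)\<^sup>2"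
      using q by (simp add: power_mult_distrib)
    then show ?thesis
      by (rule power2_le_imp_le) (use q in auto)
  qed
  have surj: "\<exists>x. A x = y" for y
  proof -
    define F where "F x = x - t *\<^sub>R (A x - y)" for x
    have "F u - F v = (u - v) - t *\<^sub>R A (u - v)" for u v
      by (simp add: F_def blinfun.bilinear_simps algebra_simps)
    then have "\<exists>!x. F x = x"
      using q contr by (intro banach_fix_type[of "sqrt q"]) (auto simp: dist_norm)
    then show ?thesis
      using c K(1) by (auto simp: F_def t_def)
  qed
  have inj: "x = y" if "A x = A y" for x y
    using le[of "x - y"] c that by (simp add: blinfun.bilinear_simps mult_le_0_iff)
  define g where "g y = (THE x. A x = y)" for y
  have g: "A (g y) = y" for y
    unfolding g_def by (rule theI') (metis surj inj)
  have g': "g (A x) = x" for x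
    by (rule inj) (rule g)
  have "bounded_linear g"
  proof (rule bounded_linear_intro[where K="1 / c"])
    show "g (x + y) = g x + g y" for x y
      by (rule inj) (simp add: g blinfun.bilinear_simps)
    show "g (r *\<^sub>R x) = r *\<^sub>R g x" for r x
      by (rule inj) (simp add: g blinfun.bilinear_simps)
    show "norm (g x) \<le> norm x * (1 / c)" for x
      using le[of "g x"] c by (simp add: g field_simps)
  qed
  then have app: "blinfun_apply (Blinfun g) = g"
    by (rule bounded_linear_Blinfun_apply)
  show ?thesis
  proof (rule op_invertibleI)
    show "Blinfun g \<in> bounded_ops"
      using bounded_ops_scaleC[OF self_adjoint_bounded[OF A]] g inj
      by (intro bounded_opsI) (auto simp: app)
  qed (auto intro!: blinfun_eqI simp: app g g')
qed

text \<open>Conversely, a positive invertible operator is bounded below, by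
  \<open>\<parallel>x\<parallel> \<le> \<parallel>A\<^sup>-\<^sup>1\<parallel> \<parallel>Ax\<parallel>\<close> and the Cauchy--Schwarz inequality above.\<close>

lemma positive_invertible_bounded_below:
  assumes A: "self_adjoint A" and pos: "\<And>x. 0 \<le> x \<bullet> A x" and inv: "op_invertible A"
  shows "\<exists>c>0. \<forall>x. c * (x \<bullet> x) \<le> x \<bullet> A x"
proof -
  define N where "N = norm (op_inverse A) + 1"
  define c where "c = 1 / (N\<^sup>2 * (norm A + 1))"
  have N: "N > 0"
    by (simp add: N_def add_nonneg_pos)
  then have c: "c > 0"
    by (simp add: c_def add_nonneg_pos)
  have "c * (x \<bullet> x) \<le> x \<bullet> A x" for x
  proof -
    have "norm x \<le> norm (op_inverse A) * norm (A x)"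
      using norm_blinfun[of "op_inverse A" "A x"] by (simp add: op_inverse_left[OF inv])
    also have "\<dots> \<le> N * norm (A x)"
      by (intro mult_right_mono) (auto simp: N_def)
    finally have "(norm x)\<^sup>2 \<le> (N * norm (A x))\<^sup>2"
      by (intro power_mono) auto
    also have "\<dots> \<le> N\<^sup>2 * ((norm A + 1) * (x \<bullet> A x))"
      using positive_norm_square_le[OF A pos] by (simp add: power_mult_distrib mult_left_mono)
    finally show ?thesis
      using N
      by (simp add: c_def power2_norm_eq_inner pos_divide_le_eq add_nonneg_pos mult.commute mult.left_commute)
  qed
  with c show ?thesis by blast
qed

lemma positive_invertible_iff:
  "A \<in> positive_invertible_ops \<longleftrightarrow> self_adjoint A \<and> (\<exists>c>0. \<forall>x. c * (x \<bullet> x) \<le> x \<bullet> A x)"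
proof safe
  fix c :: real assume A: "self_adjoint A" "c > 0" "\<forall>x. c * (x \<bullet> x) \<le> x \<bullet> A x"
  then have "0 \<le> x \<bullet> A x" for x
    by (meson inner_ge_zero less_imp_le mult_nonneg_nonneg order_trans)
  then show "A \<in> positive_invertible_ops"
    using A bounded_below_imp_invertible[of A c]
    by (auto simp: positive_invertible_ops_def positive_ops_iff)
qed (use positive_invertible_bounded_below in
  \<open>auto simp: positive_invertible_ops_def positive_ops_iff\<close>)

section \<open>Polynomials of a self-adjoint operator\<close>

lemma op_poly_eq_sum:
  assumes "degree p \<le> n"
  shows "op_poly p A = (\<Sum>i\<le>n. coeff p i *\<^sub>R (((o\<^sub>L) A ^^ i) id_blinfun))"
  unfolding op_poly_def using assms
  by (intro sum.mono_neutral_left) (auto simp: coeff_eq_0)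

lemma op_poly_0 [simp]: "op_poly 0 A = 0"
  by (simp add: op_poly_def)

lemma op_poly_pCons: "op_poly (pCons a p) A = a *\<^sub>R id_blinfun + (A o\<^sub>L op_poly p A)"
proof -
  have "op_poly (pCons a p) A =
      (\<Sum>i\<le>Suc (degree p). coeff (pCons a p) i *\<^sub>R (((o\<^sub>L) A ^^ i) id_blinfun))"
    by (rule op_poly_eq_sum) (simp add: degree_pCons_le)
  also have "\<dots> = a *\<^sub>R id_blinfun +
      (\<Sum>i\<le>degree p. coeff p i *\<^sub>R (A o\<^sub>L (((o\<^sub>L) A ^^ i) id_blinfun)))"
    by (subst sum.atMost_Suc_shift) simp
  also have "(\<Sum>i\<le>degree p. coeff p i *\<^sub>R (A o\<^sub>L (((o\<^sub>L) A ^^ i) id_blinfun))) = A o\<^sub>L op_poly p A"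
    by (intro blinfun_eqI) (simp add: op_poly_def blinfun.bilinear_simps)
  finally show ?thesis .
qed

lemma op_poly_pCons_apply: "op_poly (pCons a p) A x = a *\<^sub>R x + A (op_poly p A x)"
  by (simp add: op_poly_pCons blinfun.bilinear_simps)

lemma op_poly_add: "op_poly (p + q) A = op_poly p A + op_poly q A"
proof -
  define n where "n = max (degree p) (degree q)"
  have "degree p \<le> n" "degree q \<le> n" "degree (p + q) \<le> n"
    by (auto simp: n_def degree_add_le)
  then show ?thesis
    by (simp add: op_poly_eq_sum[of _ n] scaleR_add_left sum.distrib)
qed

lemma op_poly_smult: "op_poly (smult c p) A = c *\<^sub>R op_poly p A"
  by (simp add: op_poly_eq_sum[of "smult c p" "degree p"] degree_smult_le op_poly_def scaleR_sum_right)

lemma op_poly_diff: "op_poly (p - q) A = op_poly p A - op_poly q A"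
  using op_poly_add[of "p - q" q A] by simp

lemma op_poly_const: "op_poly [:c:] A = c *\<^sub>R id_blinfun"
  by (simp add: op_poly_pCons)

lemma op_poly_mult: "op_poly (p * q) A = op_poly p A o\<^sub>L op_poly q A"
proof (induction p)
  case (pCons a p)
  then show ?case
    by (intro blinfun_eqI)
      (simp add: op_poly_add op_poly_smult op_poly_pCons blinfun.bilinear_simps)
qed (auto intro!: blinfun_eqI)

lemma op_poly_commute: "op_poly p A o\<^sub>L op_poly q A = op_poly q A o\<^sub>L op_poly p A"
  by (metis mult.commute op_poly_mult)

lemma self_adjoint_op_poly:
  assumes "self_adjoint A"
  shows "self_adjoint (op_poly p A)"
proof (induction p)
  case 0
  then show ?case by (simp add: self_adjoint_def bounded_ops_def scaleC_scaleR
        complex_vector.scale_zero_right)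
next
  case (pCons a p)
  have "op_poly [:0, 1:] A = A"
    by (intro blinfun_eqI) (simp add: op_poly_pCons blinfun.bilinear_simps)
  then have "A o\<^sub>L op_poly p A = op_poly p A o\<^sub>L A"
    using op_poly_commute[of "[:0, 1:]" A p] by simp
  then show ?case
    using pCons assms
    by (auto simp: op_poly_pCons intro!: self_adjoint_add self_adjoint_scaleR self_adjoint_compose)
qed


section \<open>The real spectrum controls positivity\<close>

abbreviation real_spectrum :: "('a::complex_hilbert_space \<Rightarrow>\<^sub>L 'a) \<Rightarrow> real set" where
  "real_spectrum A \<equiv> {x. complex_of_real x \<in> op_spectrum A}"

lemma real_spectrum_iff: "x \<in> real_spectrum A \<longleftrightarrow> \<not> op_invertible (A - x *\<^sub>R id_blinfun)"
proof -
  have "scalar_op (complex_of_real x) = x *\<^sub>R (id_blinfun :: 'a \<Rightarrow>\<^sub>L 'a)"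
    by (intro blinfun_eqI) (simp add: scalar_op.rep_eq scaleC_of_real blinfun.bilinear_simps)
  then show ?thesis by (simp add: op_spectrum_def)
qed

lemma poly_map_of_real_add:
  "poly (map_poly complex_of_real (p + q)) z =
    poly (map_poly complex_of_real p) z + poly (map_poly complex_of_real q) z"
proof -
  have "map_poly complex_of_real (p + q) = map_poly complex_of_real p + map_poly complex_of_real q"
    by (intro poly_eqI) (simp add: coeff_map_poly)
  then show ?thesis by simp
qed

lemma poly_map_of_real_mult:
  "poly (map_poly complex_of_real (p * q)) z =
    poly (map_poly complex_of_real p) z * poly (map_poly complex_of_real q) z"
  by (induction p)
    (simp_all add: poly_map_of_real_add map_poly_smult map_poly_pCons distrib_right mult.assoc)

lemma poly_map_of_real:
  "poly (map_poly complex_of_real p) (complex_of_real x) = complex_of_real (poly p x)"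
  by (induction p) (simp_all add: map_poly_pCons)

text \<open>The remainder of \<open>p\<close> modulo this quadratic is a real polynomial \<open>a + bx\<close>; it vanishes at the non-real
  \<open>z\<close>, hence identically.\<close>

lemma quadratic_dvd_of_complex_root:
  fixes p :: "real poly"
  assumes root: "poly (map_poly complex_of_real p) z = 0" and z: "Im z \<noteq> 0"
  shows "[:(cmod z)\<^sup>2, - 2 * Re z, 1:] dvd p"
proof -
  define d where "d = [:(cmod z)\<^sup>2, - 2 * Re z, 1:]"
  define r where "r = p mod d"
  have d0: "poly (map_poly complex_of_real d) z = 0"
    unfolding d_def cmod_power2
    by (simp add: complex_eq_iff map_poly_pCons) (simp add: power2_eq_square algebra_simps)
  have "degree r < 2 \<or> r = 0"
    using degree_mod_less[of d p] by (auto simp: r_def d_def)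
  then obtain a b where r: "r = [:a, b:]"
    by (cases r rule: pCons_cases, cases "r = 0")
      (metis pCons_0_0, metis degree_eq_zeroE degree_pCons_eq_if less_2_cases_iff Suc_less_eq2 less_one
        nat.inject One_nat_def pCons_0_0)
  have "poly (map_poly complex_of_real r) z = 0"
    using root d0 poly_map_of_real_add[of "p div d * d" r z] by (simp add: r_def poly_map_of_real_mult)
  then have "r = 0"
    using z by (auto simp: r map_poly_pCons complex_eq_iff)
  then show ?thesis
    unfolding d_def[symmetric] r_def by (simp add: dvd_eq_mod_eq_0)
qed

text \<open>A real polynomial without zeros on the real spectrum is a product of factors \<open>x - a\<close> with \<open>a\<close>
  outside the spectrum and factors \<open>(x - a)\<^sup>2 + b\<^sup>2\<close>, \<open>b \<noteq> 0\<close>.  The latter become the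
  operators \<open>(A - a)\<^sup>2 + b\<^sup>2 \<ge> b\<^sup>2\<close>.\<close>

lemma op_poly_invertible:
  assumes A: "self_adjoint A"
  shows "p \<noteq> 0 \<Longrightarrow> (\<And>x. x \<in> real_spectrum A \<Longrightarrow> poly p x \<noteq> 0) \<Longrightarrow> op_invertible (op_poly p A)"
proof (induction "degree p" arbitrary: p rule: less_induct)
  case less
  have step: "op_invertible (op_poly p A)"
    if d: "d dvd p" "degree d > 0" "op_invertible (op_poly d A)" for d
  proof -
    obtain q where q: "p = d * q"
      using d(1) by (rule dvdE)
    then have "q \<noteq> 0" "degree q < degree p"
      using less.prems(1) d(2) by (auto simp: degree_mult_eq)
    then have "op_invertible (op_poly q A)"
      using less q by auto
    then show ?thesis
      using d(3) by (simp add: q op_poly_mult op_invertible_compose)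
  qed
  show ?case
  proof (cases "degree p = 0")
    case True
    then obtain c where "p = [:c:]"
      by (metis degree_eq_zeroE)
    then show ?thesis
      using less.prems(1) by (simp add: op_poly_const op_invertible_scaleR_id)
  next
    case False
    have "degree (map_poly complex_of_real p) = degree p"
      by (rule degree_map_poly) simp
    then have "\<not> constant (poly (map_poly complex_of_real p))"
      using False by (simp add: constant_degree)
    then obtain z where z: "poly (map_poly complex_of_real p) z = 0"
      using fundamental_theorem_of_algebra by blast
    show ?thesis
    proof (cases "Im z = 0")
      case True
      then have "poly p (Re z) = 0"
        using z poly_map_of_real[of p "Re z"] by (simp add: complex_is_Real_iff)
      moreover have "op_poly [:- Re z, 1:] A = A - Re z *\<^sub>R id_blinfun"
        by (intro blinfun_eqI) (simp add: op_poly_pCons blinfun.bilinear_simps)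
      ultimately show ?thesis
        using less.prems(2) real_spectrum_iff
        by (intro step[of "[:- Re z, 1:]"]) (auto simp: poly_eq_0_iff_dvd)
    next
      case False
      define d where "d = [:(cmod z)\<^sup>2, - 2 * Re z, 1:]"
      have "(Im z)\<^sup>2 * (x \<bullet> x) \<le> x \<bullet> op_poly d A x" for x
      proof -
        have "x \<bullet> op_poly d A x = (cmod z)\<^sup>2 * (x \<bullet> x) - 2 * Re z * (x \<bullet> A x) + A x \<bullet> A x"
          using A by (simp add: d_def op_poly_pCons_apply blinfun.bilinear_simps inner_simps self_adjointD)
        also have "\<dots> = (Im z)\<^sup>2 * (x \<bullet> x) + (A x - Re z *\<^sub>R x) \<bullet> (A x - Re z *\<^sub>R x)"
          using A by (simp add: cmod_power2 inner_simps self_adjointD)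
            (simp add: algebra_simps power2_eq_square)
        finally show ?thesis
          by (metis add.right_neutral add_left_mono inner_ge_zero)
      qed
      then have "op_invertible (op_poly d A)"
        using False A by (intro bounded_below_imp_invertible[of _ "(Im z)\<^sup>2"] self_adjoint_op_poly) auto
      then show ?thesis
        using quadratic_dvd_of_complex_root[OF z False] by (intro step[of d]) (auto simp: d_def)
    qed
  qed
qed

text \<open>The infimum \<open>m\<close> of the numerical range is a point of the real spectrum: otherwise the positive
  operator \<open>T - m\<close> is invertible, hence bounded below, and \<open>m\<close> is not the infimum.\<close>

lemma nonneg_of_invertible_shifts:
  fixes T :: "'a::complex_hilbert_space \<Rightarrow>\<^sub>L 'a"
  assumes T: "self_adjoint T" and inv: "\<And>s. s > 0 \<Longrightarrow> op_invertible (T + s *\<^sub>R id_blinfun)"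
  shows "0 \<le> x \<bullet> T x"
proof (rule ccontr)
  assume neg: "\<not> 0 \<le> x \<bullet> T x"
  define R where "R = (\<lambda>x. (x \<bullet> T x) / (x \<bullet> x)) ` {x. x \<noteq> 0}"
  define m where "m = Inf R"
  have "x \<noteq> 0" using neg by auto
  then have R: "(x \<bullet> T x) / (x \<bullet> x) \<in> R"
    by (auto simp: R_def)
  have bdd: "bdd_below R"
  proof (rule bdd_belowI)
    fix r assume "r \<in> R"
    then obtain y where y: "y \<noteq> 0" "r = (y \<bullet> T y) / (y \<bullet> y)"
      by (auto simp: R_def)
    have "\<bar>y \<bullet> T y\<bar> \<le> norm T * (y \<bullet> y)"
      using Cauchy_Schwarz_ineq2[of y "T y"] mult_left_mono[OF norm_blinfun[of T y], of "norm y"]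
      by (simp add: dot_square_norm power2_eq_square algebra_simps)
    then show "- norm T \<le> r"
      using y by (simp add: pos_le_divide_eq abs_le_iff)
  qed
  have "m < 0"
    using cInf_lower[OF R bdd] neg \<open>x \<noteq> 0\<close> unfolding m_def
    by (meson divide_neg_pos inner_gt_zero_iff le_less_trans not_le)
  have m: "m * (y \<bullet> y) \<le> y \<bullet> T y" for y
  proof (cases "y = 0")
    case False
    then have "m \<le> (y \<bullet> T y) / (y \<bullet> y)"
      unfolding m_def by (intro cInf_lower bdd) (auto simp: R_def)
    then show ?thesis
      using False by (simp add: field_simps)
  qed simp
  define S where "S = T + (- m) *\<^sub>R id_blinfun"
  have S: "y \<bullet> S y = y \<bullet> T y - m * (y \<bullet> y)" for y
    by (simp add: S_def blinfun.bilinear_simps inner_simps)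
  have "self_adjoint S"
    unfolding S_def by (intro self_adjoint_add self_adjoint_scaleR T) simp
  moreover have "op_invertible S"
    unfolding S_def using \<open>m < 0\<close> by (intro inv) simp
  ultimately obtain c where c: "c > 0" "\<And>y. c * (y \<bullet> y) \<le> y \<bullet> S y"
    using positive_invertible_bounded_below[of S] m by (auto simp: S)
  have "m + c \<le> Inf R"
  proof (rule cInf_greatest)
    show "R \<noteq> {}" using R by auto
    fix r assume "r \<in> R"
    then obtain y where y: "y \<noteq> 0" "r = (y \<bullet> T y) / (y \<bullet> y)"
      by (auto simp: R_def)
    then show "m + c \<le> r"
      using c(2)[of y] by (simp add: S pos_le_divide_eq distrib_right)
  qed
  then show False
    using c(1) by (simp add: m_def)
qed

text \<open>If no real shift of \<open>A\<close> failed to be invertible, then \<open>A - N\<close> would be positive for every \<open>N\<close>.\<close>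

lemma real_spectrum_nonempty:
  fixes A :: "'a::complex_hilbert_space \<Rightarrow>\<^sub>L 'a"
  assumes A: "self_adjoint A" and x: "x \<noteq> (0 :: 'a)"
  shows "real_spectrum A \<noteq> {}"
proof
  assume empty: "real_spectrum A = {}"
  define N where "N = (x \<bullet> A x) / (x \<bullet> x) + 1"
  have "0 \<le> x \<bullet> (A - N *\<^sub>R id_blinfun) x"
  proof (rule nonneg_of_invertible_shifts)
    show "self_adjoint (A - N *\<^sub>R id_blinfun)"
      by (intro self_adjoint_diff self_adjoint_scaleR A) simp
    show "op_invertible (A - N *\<^sub>R id_blinfun + s *\<^sub>R id_blinfun)" for s
      using empty real_spectrum_iff[of "N - s" A] by (simp add: algebra_simps)
  qed
  then show False
    using x inner_gt_zero_iff[of x]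
    by (simp add: N_def blinfun.bilinear_simps inner_simps field_simps del: inner_gt_zero_iff)
qed

lemma op_poly_lower_bound:
  fixes A :: "'a::complex_hilbert_space \<Rightarrow>\<^sub>L 'a"
  assumes A: "self_adjoint A" and p: "\<And>t. t \<in> real_spectrum A \<Longrightarrow> c \<le> poly p t"
  shows "c * (x \<bullet> x) \<le> x \<bullet> op_poly p A x"
proof (cases "x = 0")
  case False
  then obtain t where t: "t \<in> real_spectrum A"
    using real_spectrum_nonempty[OF A] by blast
  have "0 \<le> x \<bullet> op_poly (p - [:c:]) A x"
  proof (rule nonneg_of_invertible_shifts)
    show "self_adjoint (op_poly (p - [:c:]) A)"
      by (rule self_adjoint_op_poly[OF A])
    fix s :: real assume s: "s > 0"
    define q where "q = p - [:c:] + [:s:]"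
    have q: "poly q u > 0" if "u \<in> real_spectrum A" for u
      using p[OF that] s by (simp add: q_def)
    then have "q \<noteq> 0"
      using t by force
    then have "op_invertible (op_poly q A)"
      using q by (intro op_poly_invertible A) (assumption, metis less_irrefl)
    then show "op_invertible (op_poly (p - [:c:]) A + s *\<^sub>R id_blinfun)"
      by (simp add: q_def op_poly_add op_poly_const)
  qed
  then show ?thesis
    by (simp add: op_poly_diff op_poly_const blinfun.bilinear_simps inner_simps)
qed simp

text \<open>Applied to \<open>- p\<^sup>2 \<ge> - c\<^sup>2\<close>, the lower bound becomes a norm bound, since
  \<open>\<langle>x, p(A)\<^sup>2 x\<rangle> = \<parallel>p(A) x\<parallel>\<^sup>2\<close>.\<close>

lemma norm_op_poly_le:
  fixes A :: "'a::complex_hilbert_space \<Rightarrow>\<^sub>L 'a"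
  assumes A: "self_adjoint A" and c: "0 \<le> c" and p: "\<And>t. t \<in> real_spectrum A \<Longrightarrow> \<bar>poly p t\<bar> \<le> c"
  shows "norm (op_poly p A) \<le> c"
proof (rule norm_blinfun_bound[OF c])
  fix x
  have "- c\<^sup>2 * (x \<bullet> x) \<le> x \<bullet> op_poly (- (p * p)) A x"
    using p c by (intro op_poly_lower_bound A)
      (simp add: abs_le_square_iff[of _ c, symmetric] flip: power2_eq_square)
  also have "\<dots> = - (op_poly p A x \<bullet> op_poly p A x)"
    using op_poly_diff[of 0 "p * p" A] self_adjointD[OF self_adjoint_op_poly[OF A]]
    by (simp add: op_poly_mult blinfun.bilinear_simps)
  finally have "(norm (op_poly p A x))\<^sup>2 \<le> (c * norm x)\<^sup>2"
    by (simp add: power2_norm_eq_inner power_mult_distrib)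
  then show "norm (op_poly p A x) \<le> c * norm x"
    by (rule power2_le_imp_le) (use c in auto)
qed

section \<open>Continuous functional calculus\<close>

text \<open>The norm bound for polynomials makes the limit in the definition of \<open>f(A)\<close> independent of the
  approximating sequence.\<close>

lemma op_fun_eqI:
  assumes A: "self_adjoint A"
    and p: "uniform_limit (real_spectrum A) (\<lambda>n. poly (p n)) f sequentially"
    and T: "(\<lambda>n. op_poly (p n) A) \<longlonglongrightarrow> T"
  shows "op_fun f A = T"
  unfolding op_fun_def
proof (rule the_equality)
  show "\<exists>p. uniform_limit (real_spectrum A) (\<lambda>n. poly (p n)) f sequentially \<and>
      (\<lambda>n. op_poly (p n) A) \<longlonglongrightarrow> T"
    using p T by blast
  fix T' assume "\<exists>q. uniform_limit (real_spectrum A) (\<lambda>n. poly (q n)) f sequentially \<and>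
      (\<lambda>n. op_poly (q n) A) \<longlonglongrightarrow> T'"
  then obtain q where q: "uniform_limit (real_spectrum A) (\<lambda>n. poly (q n)) f sequentially"
    and T': "(\<lambda>n. op_poly (q n) A) \<longlonglongrightarrow> T'"
    by blast
  have "(\<lambda>n. op_poly (q n) A - op_poly (p n) A) \<longlonglongrightarrow> 0"
  proof (rule tendstoI)
    fix e :: real assume e: "e > 0"
    have "uniform_limit (real_spectrum A) (\<lambda>n t. poly (q n) t - poly (p n) t) (\<lambda>t. f t - f t) sequentially"
      by (rule uniform_limit_minus[OF q p])
    then have "\<forall>\<^sub>F n in sequentially. \<forall>t\<in>real_spectrum A. dist (poly (q n) t - poly (p n) t) (f t - f t) < e / 2"
      by (rule uniform_limitD) (use e in simp)
    then show "\<forall>\<^sub>F n in sequentially. dist (op_poly (q n) A - op_poly (p n) A) 0 < e"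
    proof eventually_elim
      case (elim n)
      have "norm (op_poly (q n - p n) A) \<le> e / 2"
        using elim e by (intro norm_op_poly_le A) (auto intro: less_imp_le)
      then show ?case
        using e by (simp add: op_poly_diff)
    qed
  qed
  moreover have "(\<lambda>n. op_poly (q n) A - op_poly (p n) A) \<longlonglongrightarrow> T' - T"
    by (rule tendsto_diff[OF T' T])
  ultimately show "T' = T"
    using LIMSEQ_unique by fastforce
qed

text \<open>The spectrum lies between the bounds of the numerical range.  All operators below are controlled
  through such bounds, so that \<open>f\<close> need only be continuous on an explicit interval.\<close>

definition op_between :: "real \<Rightarrow> ('a::complex_hilbert_space \<Rightarrow>\<^sub>L 'a) \<Rightarrow> real \<Rightarrow> bool" where
  "op_between m A M \<longleftrightarrow>
     self_adjoint A \<and> (\<forall>x. m * (x \<bullet> x) \<le> x \<bullet> A x \<and> x \<bullet> A x \<le> M * (x \<bullet> x))"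

lemma op_between_self_adjoint: "op_between m A M \<Longrightarrow> self_adjoint A"
  by (simp add: op_between_def)

lemma op_between_lower: "op_between m A M \<Longrightarrow> m * (x \<bullet> x) \<le> x \<bullet> A x"
  and op_between_upper: "op_between m A M \<Longrightarrow> x \<bullet> A x \<le> M * (x \<bullet> x)"
  by (simp_all add: op_between_def)

lemma op_between_mono:
  assumes "op_between m A M" "m' \<le> m" "M \<le> M'"
  shows "op_between m' A M'"
  using assms unfolding op_between_def
  by (meson inner_ge_zero mult_right_mono order_trans)

lemma op_between_norm:
  assumes "self_adjoint A"
  shows "op_between (- norm A) A (norm A)"
proof -
  have "\<bar>x \<bullet> A x\<bar> \<le> norm A * (x \<bullet> x)" for x
    using Cauchy_Schwarz_ineq2[of x "A x"] mult_left_mono[OF norm_blinfun[of A x], of "norm x"]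
    by (simp add: dot_square_norm power2_eq_square algebra_simps)
  then show ?thesis
    using assms by (auto simp: op_between_def abs_le_iff)
      (metis minus_le_iff)
qed

lemma positive_ops_between: "A \<in> positive_ops \<longleftrightarrow> (\<exists>M. op_between 0 A M)"
  using op_between_norm[of A] by (auto simp: positive_ops_iff op_between_def)

lemma positive_invertible_between:
  "A \<in> positive_invertible_ops \<longleftrightarrow> (\<exists>m M. 0 < m \<and> op_between m A M)"
  using op_between_norm[of A] unfolding positive_invertible_iff op_between_def by blast

lemma op_between_id [simp]: "op_between 1 id_blinfun 1"
  by (simp add: op_between_def)

lemma real_spectrum_subset:
  assumes "op_between m A M"
  shows "real_spectrum A \<subseteq> {m..M}"
proof
  fix t assume t: "t \<in> real_spectrum A"
  have sa: "self_adjoint (A - t *\<^sub>R id_blinfun)" "self_adjoint (t *\<^sub>R id_blinfun - A)"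
    using assms by (auto simp: op_between_def intro!: self_adjoint_diff self_adjoint_scaleR)
  have "op_invertible (A - t *\<^sub>R id_blinfun)" if "t < m"
    using assms that by (intro bounded_below_imp_invertible[of _ "m - t"] sa)
      (auto simp: op_between_def blinfun.bilinear_simps inner_simps left_diff_distrib)
  moreover have "op_invertible (A - t *\<^sub>R id_blinfun)" if "M < t"
  proof -
    have "op_invertible (t *\<^sub>R id_blinfun - A)"
      using assms that by (intro bounded_below_imp_invertible[of _ "t - M"] sa)
        (auto simp: op_between_def blinfun.bilinear_simps inner_simps left_diff_distrib)
    then have "op_invertible (((-1) *\<^sub>R id_blinfun) o\<^sub>L (t *\<^sub>R id_blinfun - A))"
      by (intro op_invertible_compose op_invertible_scaleR_id) auto
    moreover have "((-1) *\<^sub>R id_blinfun) o\<^sub>L (t *\<^sub>R id_blinfun - A) = A - t *\<^sub>R id_blinfun"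
      by (intro blinfun_eqI) (simp add: blinfun.bilinear_simps)
    ultimately show ?thesis by simp
  qed
  ultimately show "t \<in> {m..M}"
    using t real_spectrum_iff by force
qed

lemma weierstrass_poly:
  fixes f :: "real \<Rightarrow> real"
  assumes "continuous_on {m..M} f"
  shows "\<exists>p. uniform_limit {m..M} (\<lambda>n. poly (p n)) f sequentially"
proof -
  have "\<exists>p. \<forall>t\<in>{m..M}. \<bar>f t - poly p t\<bar> < 1 / Suc n" for n
  proof -
    obtain g where g: "real_polynomial_function g" "\<And>t. t \<in> {m..M} \<Longrightarrow> \<bar>f t - g t\<bar> < 1 / Suc n"
      using Stone_Weierstrass_real_polynomial_function[of "{m..M}" f "1 / Suc n"] assms by auto
    then obtain a N where "g = (\<lambda>t. \<Sum>i\<le>N. a i * t ^ i)"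
      using real_polynomial_function_iff_sum by blast
    then have "g = poly (\<Sum>i\<le>N. monom (a i) i)"
      by (simp add: fun_eq_iff poly_sum poly_monom)
    then show ?thesis using g(2) by blast
  qed
  then obtain p where p: "\<And>n t. t \<in> {m..M} \<Longrightarrow> \<bar>f t - poly (p n) t\<bar> < 1 / Suc n"
    by metis
  have "uniform_limit {m..M} (\<lambda>n. poly (p n)) f sequentially"
  proof (rule uniform_limitI)
    fix e :: real assume "e > 0"
    then obtain N where N: "1 / Suc N < e"
      using nat_approx_posE by blast
    show "\<forall>\<^sub>F n in sequentially. \<forall>t\<in>{m..M}. dist (poly (p n) t) (f t) < e"
    proof (rule eventually_sequentiallyI[of N], rule ballI)
      fix n t assume "N \<le> n" and t: "t \<in> {m..M}"
      then have "1 / real (Suc n) \<le> 1 / real (Suc N)"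
        by (intro divide_left_mono) auto
      then show "dist (poly (p n) t) (f t) < e"
        using p[OF t, of n] N by (simp add: dist_real_def abs_minus_commute)
    qed
  qed
  then show ?thesis by blast
qed

lemma op_poly_tendsto_op_fun:
  fixes A :: "'a::complex_hilbert_space \<Rightarrow>\<^sub>L 'a"
  assumes A: "op_between m A M" and p: "uniform_limit {m..M} (\<lambda>n. poly (p n)) f sequentially"
  shows "(\<lambda>n. op_poly (p n) A) \<longlonglongrightarrow> op_fun f A"
proof -
  note sa = op_between_self_adjoint[OF A]
  have "Cauchy (\<lambda>n. op_poly (p n) A)"
  proof (rule metric_CauchyI)
    fix e :: real assume e: "e > 0"
    then obtain N where N: "\<And>n t. n \<ge> N \<Longrightarrow> t \<in> {m..M} \<Longrightarrow> dist (poly (p n) t) (f t) < e / 4"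
      using uniform_limitD[OF p, of "e / 4"] by (force simp: eventually_sequentially)
    have "dist (op_poly (p i) A) (op_poly (p j) A) < e" if "i \<ge> N" "j \<ge> N" for i j
    proof -
      have "norm (op_poly (p i - p j) A) \<le> e / 2"
      proof (rule norm_op_poly_le[OF sa])
        fix t assume "t \<in> real_spectrum A"
        then have "t \<in> {m..M}"
          using real_spectrum_subset[OF A] by blast
        then show "\<bar>poly (p i - p j) t\<bar> \<le> e / 2"
          using N[OF that(1), of t] N[OF that(2), of t]
          unfolding poly_diff dist_real_def by arith
      qed (use e in simp)
      then show ?thesis
        using e by (simp add: dist_norm op_poly_diff)
    qed
    then show "\<exists>N. \<forall>i\<ge>N. \<forall>j\<ge>N. dist (op_poly (p i) A) (op_poly (p j) A) < e"
      by blast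
  qed
  then obtain T where T: "(\<lambda>n. op_poly (p n) A) \<longlonglongrightarrow> T"
    using Cauchy_convergent convergent_def by blast
  moreover have "op_fun f A = T"
    by (rule op_fun_eqI[OF sa uniform_limit_on_subset[OF p real_spectrum_subset[OF A]] T])
  ultimately show ?thesis by simp
qed

lemma op_fun_approx:
  assumes "op_between m A M" "continuous_on {m..M} f"
  obtains p where "uniform_limit {m..M} (\<lambda>n. poly (p n)) f sequentially"
    "(\<lambda>n. op_poly (p n) A) \<longlonglongrightarrow> op_fun f A"
  using weierstrass_poly op_poly_tendsto_op_fun assms by metis

lemma op_fun_cong:
  assumes A: "op_between m A M" and fg: "\<And>t. m \<le> t \<Longrightarrow> t \<le> M \<Longrightarrow> f t = g t"
  shows "op_fun f A = op_fun g A"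
proof -
  have "uniform_limit (real_spectrum A) F f sequentially \<longleftrightarrow>
      uniform_limit (real_spectrum A) F g sequentially" for F :: "nat \<Rightarrow> real \<Rightarrow> real"
    using real_spectrum_subset[OF A] fg by (intro uniform_limit_cong') auto
  then show ?thesis
    by (simp add: op_fun_def)
qed

lemma op_fun_poly: "op_between m A M \<Longrightarrow> op_fun (poly p) A = op_poly p A"
  by (rule op_fun_eqI[where p = "\<lambda>_. p"]) (auto simp: op_between_self_adjoint uniform_limit_const)

lemma op_fun_const:
  assumes "op_between m A M"
  shows "op_fun (\<lambda>t. c) A = c *\<^sub>R id_blinfun"
proof -
  have "(\<lambda>t. c) = poly [:c:]" by (simp add: fun_eq_iff)
  then show ?thesis
    using op_fun_poly[OF assms, of "[:c:]"] by (simp only: op_poly_const)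
qed

lemma op_fun_id:
  assumes "op_between m A M"
  shows "op_fun (\<lambda>t. t) A = A"
proof -
  have "op_poly [:0, 1:] A = A"
    by (intro blinfun_eqI) (simp add: op_poly_pCons blinfun.bilinear_simps)
  moreover have "(\<lambda>t. t) = poly [:0, 1 :: real:]" by (simp add: fun_eq_iff)
  ultimately show ?thesis
    using op_fun_poly[OF assms, of "[:0, 1:]"] by (simp only:)
qed

lemma self_adjoint_op_fun:
  assumes "op_between m A M" "continuous_on {m..M} f"
  shows "self_adjoint (op_fun f A)"
  using op_fun_approx[OF assms] self_adjoint_limit self_adjoint_op_poly
    op_between_self_adjoint[OF assms(1)] by metis

lemma op_fun_add:
  assumes A: "op_between m A M" and f: "continuous_on {m..M} f" and g: "continuous_on {m..M} g"
  shows "op_fun (\<lambda>t. f t + g t) A = op_fun f A + op_fun g A"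
proof -
  obtain p where p: "uniform_limit {m..M} (\<lambda>n. poly (p n)) f sequentially"
    "(\<lambda>n. op_poly (p n) A) \<longlonglongrightarrow> op_fun f A"
    using op_fun_approx[OF A f] by blast
  obtain q where q: "uniform_limit {m..M} (\<lambda>n. poly (q n)) g sequentially"
    "(\<lambda>n. op_poly (q n) A) \<longlonglongrightarrow> op_fun g A"
    using op_fun_approx[OF A g] by blast
  have "uniform_limit {m..M} (\<lambda>n. poly (p n + q n)) (\<lambda>t. f t + g t) sequentially"
    using uniform_limit_add[OF p(1) q(1)] by (subst ext[OF poly_add])
  from op_poly_tendsto_op_fun[OF A this] show ?thesis
    using tendsto_add[OF p(2) q(2)] LIMSEQ_unique by (simp add: op_poly_add) blast
qed

lemma op_fun_mult:
  assumes A: "op_between m A M" and f: "continuous_on {m..M} f" and g: "continuous_on {m..M} g"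
  shows "op_fun (\<lambda>t. f t * g t) A = op_fun f A o\<^sub>L op_fun g A"
proof -
  obtain p where p: "uniform_limit {m..M} (\<lambda>n. poly (p n)) f sequentially"
    "(\<lambda>n. op_poly (p n) A) \<longlonglongrightarrow> op_fun f A"
    using op_fun_approx[OF A f] by blast
  obtain q where q: "uniform_limit {m..M} (\<lambda>n. poly (q n)) g sequentially"
    "(\<lambda>n. op_poly (q n) A) \<longlonglongrightarrow> op_fun g A"
    using op_fun_approx[OF A g] by blast
  have "bounded (f ` {m..M})" "bounded (g ` {m..M})"
    using f g by (auto intro!: compact_imp_bounded compact_continuous_image)
  then have "uniform_limit {m..M} (\<lambda>n. poly (p n * q n)) (\<lambda>t. f t * g t) sequentially"
    using uniform_lim_mult[OF p(1) q(1)] by (subst ext[OF poly_mult])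
  from op_poly_tendsto_op_fun[OF A this]
  have "(\<lambda>n. op_poly (p n) A o\<^sub>L op_poly (q n) A) \<longlonglongrightarrow> op_fun (\<lambda>t. f t * g t) A"
    by (simp add: op_poly_mult)
  moreover have "(\<lambda>n. op_poly (p n) A o\<^sub>L op_poly (q n) A) \<longlonglongrightarrow> (op_fun f A o\<^sub>L op_fun g A)"
    by (rule bounded_bilinear.tendsto[OF bounded_bilinear_blinfun_compose p(2) q(2)])
  ultimately show ?thesis
    by (rule LIMSEQ_unique)
qed

lemma op_fun_scaleR:
  assumes A: "op_between m A M" and f: "continuous_on {m..M} f"
  shows "op_fun (\<lambda>t. c * f t) A = c *\<^sub>R op_fun f A"
  using op_fun_mult[OF A _ f, of "\<lambda>_. c"]
  by (auto simp: op_fun_const[OF A] blinfun.bilinear_simps intro!: blinfun_eqI)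

lemma op_fun_uminus:
  assumes "op_between m A M" "continuous_on {m..M} f"
  shows "op_fun (\<lambda>t. - f t) A = - op_fun f A"
  using op_fun_scaleR[OF assms, of "-1"] by simp

lemma op_fun_diff:
  assumes A: "op_between m A M" and f: "continuous_on {m..M} f" and g: "continuous_on {m..M} g"
  shows "op_fun (\<lambda>t. f t - g t) A = op_fun f A - op_fun g A"
  using op_fun_add[OF A f continuous_on_minus[OF g]] op_fun_uminus[OF A g] by simp

text \<open>A nonnegative continuous function is a square, and \<open>\<langle>x, g(A)\<^sup>2 x\<rangle> = \<parallel>g(A) x\<parallel>\<^sup>2\<close>.\<close>

lemma op_fun_nonneg:
  assumes A: "op_between m A M" and f: "continuous_on {m..M} f"
    and nonneg: "\<And>t. m \<le> t \<Longrightarrow> t \<le> M \<Longrightarrow> 0 \<le> f t"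
  shows "0 \<le> x \<bullet> op_fun f A x"
proof -
  have g: "continuous_on {m..M} (\<lambda>t. sqrt (f t))"
    by (intro continuous_intros f)
  have "op_fun f A = op_fun (\<lambda>t. sqrt (f t) * sqrt (f t)) A"
    by (intro op_fun_cong[OF A]) (use nonneg in simp)
  also have "\<dots> = op_fun (\<lambda>t. sqrt (f t)) A o\<^sub>L op_fun (\<lambda>t. sqrt (f t)) A"
    by (rule op_fun_mult[OF A g g])
  finally show ?thesis
    using self_adjointD[OF self_adjoint_op_fun[OF A g], of x "op_fun (\<lambda>t. sqrt (f t)) A x"] by simp
qed

lemma op_fun_mono:
  assumes A: "op_between m A M" and f: "continuous_on {m..M} f" and g: "continuous_on {m..M} g"
    and le: "\<And>t. m \<le> t \<Longrightarrow> t \<le> M \<Longrightarrow> f t \<le> g t"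
  shows "x \<bullet> op_fun f A x \<le> x \<bullet> op_fun g A x"
  using op_fun_nonneg[OF A continuous_on_diff[OF g f], of x] le
  by (simp add: op_fun_diff[OF A g f] blinfun.bilinear_simps inner_simps)

lemma op_between_op_fun:
  assumes A: "op_between m A M" and f: "continuous_on {m..M} f"
    and bounds: "\<And>t. m \<le> t \<Longrightarrow> t \<le> M \<Longrightarrow> c \<le> f t \<and> f t \<le> d"
  shows "op_between c (op_fun f A) d"
  unfolding op_between_def
proof (intro conjI allI)
  show "self_adjoint (op_fun f A)"
    by (rule self_adjoint_op_fun[OF A f])
  fix x
  show "c * (x \<bullet> x) \<le> x \<bullet> op_fun f A x"
    using op_fun_mono[OF A continuous_on_const f, of c x] bounds
    by (simp add: op_fun_const[OF A] blinfun.bilinear_simps)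
  show "x \<bullet> op_fun f A x \<le> d * (x \<bullet> x)"
    using op_fun_mono[OF A f continuous_on_const, of d x] bounds
    by (simp add: op_fun_const[OF A] blinfun.bilinear_simps)
qed

text \<open>For continuous \<open>f\<close> with positive values the image of \<open>[m, M]\<close> is a compact subset of
  \<open>(0, \<infinity>)\<close>.\<close>

lemma continuous_pos_bounds:
  fixes f :: "real \<Rightarrow> real"
  assumes "continuous_on {m..M} f" "\<And>t. m \<le> t \<Longrightarrow> t \<le> M \<Longrightarrow> 0 < f t"
  obtains c d where "0 < c" "\<And>t. m \<le> t \<Longrightarrow> t \<le> M \<Longrightarrow> c \<le> f t \<and> f t \<le> d"
proof (cases "m \<le> M")
  case True
  then obtain u v where u: "u \<in> {m..M}" "\<And>t. t \<in> {m..M} \<Longrightarrow> f u \<le> f t"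
    and v: "v \<in> {m..M}" "\<And>t. t \<in> {m..M} \<Longrightarrow> f t \<le> f v"
    using continuous_attains_inf[of "{m..M}" f] continuous_attains_sup[of "{m..M}" f] assms(1)
    by (metis atLeastAtMost_iff compact_Icc empty_iff order_refl)
  with assms(2)[of u] show ?thesis
    by (intro that[of "f u" "f v"]) auto
qed (use that[of 1 1] in auto)

lemma op_fun_positive_invertible:
  assumes A: "op_between m A M" and f: "continuous_on {m..M} f"
    and pos: "\<And>t. m \<le> t \<Longrightarrow> t \<le> M \<Longrightarrow> 0 < f t"
  shows "op_fun f A \<in> positive_invertible_ops"
  using continuous_pos_bounds[OF f pos] op_between_op_fun[OF A f]
  by (metis positive_invertible_between)

lemma norm_op_fun_le:
  assumes A: "op_between m A M" and f: "continuous_on {m..M} f"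
    and le: "\<And>t. m \<le> t \<Longrightarrow> t \<le> M \<Longrightarrow> \<bar>f t\<bar> \<le> c" and c: "0 \<le> c"
  shows "norm (op_fun f A) \<le> c"
proof (rule norm_blinfun_bound[OF c])
  fix x
  have "x \<bullet> op_fun (\<lambda>t. f t * f t) A x \<le> x \<bullet> op_fun (\<lambda>t. c\<^sup>2) A x"
    using le by (intro op_fun_mono[OF A] continuous_intros f)
      (metis abs_ge_zero power2_abs power2_eq_square power_mono)
  then have "(norm (op_fun f A x))\<^sup>2 \<le> (c * norm x)\<^sup>2"
    by (simp add: op_fun_mult[OF A f f] op_fun_const[OF A] blinfun.bilinear_simps power_mult_distrib
        power2_norm_eq_inner self_adjointD[OF self_adjoint_op_fun[OF A f]])
  then show "norm (op_fun f A x) \<le> c * norm x"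
    by (rule power2_le_imp_le) (use c in auto)
qed

lemma op_poly_op_fun:
  assumes A: "op_between m A M" and f: "continuous_on {m..M} f"
  shows "op_poly p (op_fun f A) = op_fun (\<lambda>t. poly p (f t)) A"
proof (induction p)
  case 0
  then show ?case using op_fun_const[OF A, of 0] by simp
next
  case (pCons a p)
  have pf: "continuous_on {m..M} (\<lambda>t. poly p (f t))"
    by (intro continuous_intros f)
  have "op_fun (\<lambda>t. poly (pCons a p) (f t)) A =
      op_fun (\<lambda>t. a) A + op_fun (\<lambda>t. f t * poly p (f t)) A"
    by (simp add: op_fun_add[OF A] f pf continuous_on_mult)
  also have "\<dots> = op_poly (pCons a p) (op_fun f A)"
    by (simp add: op_fun_const[OF A] op_fun_mult[OF A f pf] op_poly_pCons pCons.IH)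
  finally show ?case by simp
qed

text \<open>For a polynomial \<open>g\<close> this is the homomorphism property; a general \<open>g\<close> is a uniform limit of
  polynomials, and the norm bound carries the identity over to the limit.\<close>

lemma op_fun_compose:
  assumes A: "op_between m A M" and f: "continuous_on {m..M} f"
    and bounds: "\<And>t. m \<le> t \<Longrightarrow> t \<le> M \<Longrightarrow> c \<le> f t \<and> f t \<le> d"
    and g: "continuous_on {c..d} g"
  shows "op_fun g (op_fun f A) = op_fun (\<lambda>t. g (f t)) A"
proof -
  obtain p where p: "uniform_limit {c..d} (\<lambda>n. poly (p n)) g sequentially"
    "(\<lambda>n. op_poly (p n) (op_fun f A)) \<longlonglongrightarrow> op_fun g (op_fun f A)"
    using op_fun_approx[OF op_between_op_fun[OF A f bounds] g] by blast
  have gf: "continuous_on {m..M} (\<lambda>t. g (f t))"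
    by (rule continuous_on_compose2[OF g f]) (use bounds in auto)
  have pf: "continuous_on {m..M} (\<lambda>t. poly (p n) (f t))" for n
    by (intro continuous_intros f)
  have "(\<lambda>n. op_fun (\<lambda>t. poly (p n) (f t)) A - op_fun (\<lambda>t. g (f t)) A) \<longlonglongrightarrow> 0"
  proof (rule tendstoI)
    fix e :: real assume e: "e > 0"
    then have "\<forall>\<^sub>F n in sequentially. \<forall>s\<in>{c..d}. dist (poly (p n) s) (g s) < e / 2"
      using uniform_limitD[OF p(1), of "e / 2"] by auto
    then show "\<forall>\<^sub>F n in sequentially.
        dist (op_fun (\<lambda>t. poly (p n) (f t)) A - op_fun (\<lambda>t. g (f t)) A) 0 < e"
    proof eventually_elim
      case (elim n)
      have "norm (op_fun (\<lambda>t. poly (p n) (f t) - g (f t)) A) \<le> e / 2"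
      proof (rule norm_op_fun_le[OF A])
        show "continuous_on {m..M} (\<lambda>t. poly (p n) (f t) - g (f t))"
          by (intro continuous_on_diff pf gf)
        show "\<bar>poly (p n) (f t) - g (f t)\<bar> \<le> e / 2" if "m \<le> t" "t \<le> M" for t
          using elim bounds[OF that] by (auto simp: dist_real_def intro: less_imp_le)
      qed (use e in simp)
      then show ?case
        using e by (simp add: op_fun_diff[OF A pf gf])
    qed
  qed
  then have "(\<lambda>n. op_poly (p n) (op_fun f A)) \<longlonglongrightarrow> op_fun (\<lambda>t. g (f t)) A"
    by (simp add: op_poly_op_fun[OF A f] LIM_zero_iff)
  with p(2) show ?thesis
    by (rule LIMSEQ_unique)
qed

lemma op_fun_inverse:
  assumes A: "op_between m A M" and f: "continuous_on {m..M} f"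
    and nz: "\<And>t. m \<le> t \<Longrightarrow> t \<le> M \<Longrightarrow> f t \<noteq> 0"
  shows "op_inverse (op_fun f A) = op_fun (\<lambda>t. 1 / f t) A"
proof -
  have g: "continuous_on {m..M} (\<lambda>t. 1 / f t)"
    by (intro continuous_intros f) (use nz in auto)
  have one: "op_fun (\<lambda>t. 1) A = id_blinfun"
    using op_fun_const[OF A, of 1] by simp
  show ?thesis
  proof (rule op_inverse_eqI)
    show "op_fun (\<lambda>t. 1 / f t) A \<in> bounded_ops"
      by (rule self_adjoint_bounded[OF self_adjoint_op_fun[OF A g]])
    show "op_fun f A o\<^sub>L op_fun (\<lambda>t. 1 / f t) A = id_blinfun"
      unfolding op_fun_mult[OF A f g, symmetric] one[symmetric]
      by (rule op_fun_cong[OF A]) (use nz in simp)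
    show "op_fun (\<lambda>t. 1 / f t) A o\<^sub>L op_fun f A = id_blinfun"
      unfolding op_fun_mult[OF A g f, symmetric] one[symmetric]
      by (rule op_fun_cong[OF A]) (use nz in simp)
  qed
qed

lemma op_inverse_eq_op_fun:
  assumes "op_between m A M" "0 < m"
  shows "op_inverse A = op_fun (\<lambda>t. 1 / t) A"
  using op_fun_inverse[OF assms(1) continuous_on_id] assms(2)
  by (simp add: op_fun_id[OF assms(1)])

lemma op_fun_eigenvector:
  assumes A: "op_between m A M" and f: "continuous_on {m..M} f"
    and x: "A x = a *\<^sub>R x" "x \<noteq> 0"
  shows "op_fun f A x = f a *\<^sub>R x"
proof -
  obtain p where p: "uniform_limit {m..M} (\<lambda>n. poly (p n)) f sequentially"
    "(\<lambda>n. op_poly (p n) A) \<longlonglongrightarrow> op_fun f A"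
    using op_fun_approx[OF A f] by blast
  have "a \<in> {m..M}"
    using op_between_lower[OF A, of x] op_between_upper[OF A, of x] x by simp
  then have "(\<lambda>n. poly (p n) a) \<longlonglongrightarrow> f a"
    by (rule tendsto_uniform_limitI[OF p(1)])
  then have "(\<lambda>n. poly (p n) a *\<^sub>R x) \<longlonglongrightarrow> f a *\<^sub>R x"
    by (intro tendsto_intros)
  moreover have "op_poly q A x = poly q a *\<^sub>R x" for q
    by (induction q) (simp_all add: op_poly_pCons_apply blinfun.bilinear_simps x algebra_simps)
  moreover have "(\<lambda>n. op_poly (p n) A x) \<longlonglongrightarrow> op_fun f A x"
    by (rule bounded_linear.tendsto[OF blinfun.bounded_linear_left p(2)])
  ultimately show ?thesis
    using LIMSEQ_unique by auto
qed

text \<open>Polynomials respect every similarity, and both sides are limits of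
  the same polynomials.\<close>

lemma op_fun_similarity:
  fixes A S S' :: "'a::complex_hilbert_space \<Rightarrow>\<^sub>L 'a"
  assumes A: "op_between m A M" and f: "continuous_on {m..M} f"
    and B: "op_between m (S o\<^sub>L A o\<^sub>L S') M" and inv: "S' o\<^sub>L S = id_blinfun" "S o\<^sub>L S' = id_blinfun"
  shows "op_fun f (S o\<^sub>L A o\<^sub>L S') = S o\<^sub>L op_fun f A o\<^sub>L S'"
proof -
  obtain p where p: "uniform_limit {m..M} (\<lambda>n. poly (p n)) f sequentially"
    "(\<lambda>n. op_poly (p n) A) \<longlonglongrightarrow> op_fun f A"
    using op_fun_approx[OF A f] by blast
  have S: "S' (S x) = x" "S (S' x) = x" for x :: 'a
    using inv by (metis blinfun_apply_blinfun_compose blinfun_apply_id_blinfun)+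
  have "op_poly q (S o\<^sub>L A o\<^sub>L S') = S o\<^sub>L op_poly q A o\<^sub>L S'" for q
  proof (rule blinfun_eqI)
    show "op_poly q (S o\<^sub>L A o\<^sub>L S') x = (S o\<^sub>L op_poly q A o\<^sub>L S') x" for x
      by (induction q) (simp_all add: op_poly_pCons_apply blinfun.bilinear_simps S)
  qed
  moreover have "(\<lambda>n. S o\<^sub>L op_poly (p n) A o\<^sub>L S') \<longlonglongrightarrow> (S o\<^sub>L op_fun f A o\<^sub>L S')"
    by (intro bounded_bilinear.tendsto[OF bounded_bilinear_blinfun_compose] tendsto_const p(2))
  ultimately show ?thesis
    using op_poly_tendsto_op_fun[OF B p(1)] LIMSEQ_unique by auto
qed

section \<open>Operator means in normal form\<close>

lemma positive_invertibleD:
  assumes "A \<in> positive_invertible_ops"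
  shows positive_invertible_self_adjoint: "self_adjoint A"
    and positive_invertible_invertible: "op_invertible A"
  using assms by (auto simp: positive_invertible_iff intro: bounded_below_imp_invertible)

lemma positive_invertible_id [simp]: "id_blinfun \<in> positive_invertible_ops"
  using op_between_id positive_invertible_between zero_less_one by blast

lemma positive_invertible_scaleR:
  "A \<in> positive_invertible_ops \<Longrightarrow> 0 < r \<Longrightarrow> r *\<^sub>R A \<in> positive_invertible_ops"
  unfolding positive_invertible_iff
  by (auto simp: self_adjoint_scaleR blinfun.bilinear_simps mult.assoc)
    (metis mult.assoc mult_le_cancel_left_pos mult_pos_pos)

lemma positive_invertible_add:
  assumes "A \<in> positive_invertible_ops" "B \<in> positive_ops"
  shows "A + B \<in> positive_invertible_ops"
  using assms unfolding positive_invertible_iff positive_ops_iff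
  by (auto simp: self_adjoint_add blinfun.bilinear_simps inner_simps intro: add_increasing2)

lemma positive_invertible_imp_positive: "A \<in> positive_invertible_ops \<Longrightarrow> A \<in> positive_ops"
  by (simp add: positive_invertible_ops_def)

lemma positive_invertible_inverse:
  assumes "A \<in> positive_invertible_ops"
  shows "op_inverse A \<in> positive_invertible_ops"
proof -
  obtain m M where A: "0 < m" "op_between m A M"
    using assms by (auto simp: positive_invertible_between)
  then have "op_fun (\<lambda>t. 1 / t) A \<in> positive_invertible_ops"
    by (intro op_fun_positive_invertible[OF A(2)] continuous_intros) auto
  then show ?thesis
    using op_inverse_eq_op_fun[OF A(2,1)] by simp
qed

lemma op_inverse_op_inverse: "A \<in> positive_invertible_ops \<Longrightarrow> op_inverse (op_inverse A) = A"
  by (rule op_inverse_eqI)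
    (auto simp: self_adjoint_bounded positive_invertibleD op_inverse_left op_inverse_right
      intro!: blinfun_eqI)

lemma positive_invertible_congruence:
  assumes R: "self_adjoint R" "op_invertible R" and A: "A \<in> positive_invertible_ops"
  shows "R o\<^sub>L A o\<^sub>L R \<in> positive_invertible_ops"
proof -
  have "x \<bullet> (R o\<^sub>L A o\<^sub>L R) x = R x \<bullet> A (R x)" for x
    using self_adjointD[OF R(1), of x "A (R x)"] by simp
  then show ?thesis
    using assms positive_invertible_self_adjoint[OF A]
    by (auto simp: positive_invertible_ops_def positive_ops_iff op_invertible_compose
        self_adjoint_congruence)
qed

lemma op_inverse_congruence:
  assumes "op_invertible R" "op_invertible A"
  shows "op_inverse (R o\<^sub>L A o\<^sub>L R) = op_inverse R o\<^sub>L op_inverse A o\<^sub>L op_inverse R"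
  by (rule op_inverse_eqI)
    (use assms in \<open>auto simp: bounded_ops_compose op_inverse_bounded op_inverse_left op_inverse_right
      intro!: blinfun_eqI\<close>)

lemma sqrt_positive_invertible:
  assumes "A \<in> positive_invertible_ops"
  shows "op_fun sqrt A \<in> positive_invertible_ops" and "op_fun sqrt A o\<^sub>L op_fun sqrt A = A"
proof -
  obtain m M where A: "0 < m" "op_between m A M"
    using assms by (auto simp: positive_invertible_between)
  have s: "continuous_on {m..M} sqrt"
    by (intro continuous_intros)
  show "op_fun sqrt A \<in> positive_invertible_ops"
    using A(1) by (intro op_fun_positive_invertible[OF A(2) s]) auto
  have "op_fun sqrt A o\<^sub>L op_fun sqrt A = op_fun (\<lambda>t. sqrt t * sqrt t) A"
    using op_fun_mult[OF A(2) s s] by simp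
  also have "\<dots> = op_fun (\<lambda>t. t) A"
    using A(1) by (intro op_fun_cong[OF A(2)]) simp
  finally show "op_fun sqrt A o\<^sub>L op_fun sqrt A = A"
    using op_fun_id[OF A(2)] by simp
qed

text \<open>The mean of two operators \<open>R p(T) R\<close> and \<open>R q(T) R\<close> is computed by calculating with the
  functions \<open>p\<close> and \<open>q\<close>.  With \<open>X = R p(T) R\<close> and \<open>W = p(T)\<^sup>1\<^sup>/\<^sup>2\<close> the operator
  \<open>S = X\<^sup>-\<^sup>1\<^sup>/\<^sup>2 R W\<close> is unitary, since \<open>S (W R X\<^sup>-\<^sup>1\<^sup>/\<^sup>2) = 1\<close>; it conjugates \<open>(q/p)(T)\<close> to
  \<open>X\<^sup>-\<^sup>1\<^sup>/\<^sup>2 R q(T) R X\<^sup>-\<^sup>1\<^sup>/\<^sup>2\<close>, and \<open>X\<^sup>1\<^sup>/\<^sup>2 S = R W\<close>.\<close>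

lemma kubo_ando_congruence:
  fixes R T :: "'a::complex_hilbert_space \<Rightarrow>\<^sub>L 'a"
  assumes R: "self_adjoint R" "op_invertible R" and T: "op_between m T M"
    and p: "continuous_on {m..M} p" "\<And>t. m \<le> t \<Longrightarrow> t \<le> M \<Longrightarrow> 0 < p t"
    and q: "continuous_on {m..M} q" "\<And>t. m \<le> t \<Longrightarrow> t \<le> M \<Longrightarrow> 0 < q t"
    and h: "continuous_on {0<..} h"
  shows "kubo_ando h (R o\<^sub>L op_fun p T o\<^sub>L R) (R o\<^sub>L op_fun q T o\<^sub>L R) =
    R o\<^sub>L op_fun (\<lambda>t. p t * h (q t / p t)) T o\<^sub>L R"
proof -
  define X Y where "X = R o\<^sub>L op_fun p T o\<^sub>L R" and "Y = R o\<^sub>L op_fun q T o\<^sub>L R"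
  define V where "V = op_fun sqrt X"
  define V' where "V' = op_inverse V"
  define W where "W = op_fun (\<lambda>t. sqrt (p t)) T"
  define W' where "W' = op_inverse W"
  define R' where "R' = op_inverse R"
  define Q where "Q = op_fun (\<lambda>t. q t / p t) T"
  have X: "X \<in> positive_invertible_ops" and Y: "Y \<in> positive_invertible_ops"
    unfolding X_def Y_def
    by (intro positive_invertible_congruence[OF R] op_fun_positive_invertible[OF T] p q; simp)+
  have V: "V \<in> positive_invertible_ops" and VV: "V (V x) = X x" for x
    using sqrt_positive_invertible[OF X] by (simp_all add: V_def flip: blinfun_apply_blinfun_compose)
  have sp: "continuous_on {m..M} (\<lambda>t. sqrt (p t))"
    by (intro continuous_intros p)
  have W: "W \<in> positive_invertible_ops"
    unfolding W_def using p(2) by (intro op_fun_positive_invertible[OF T sp]) simp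
  have inv: "V (V' x) = x" "V' (V x) = x" "W (W' x) = x" "W' (W x) = x"
      "R (R' x) = x" "R' (R x) = x" for x
    using positive_invertible_invertible[OF V] positive_invertible_invertible[OF W] R(2)
    by (simp_all add: V'_def W'_def R'_def op_inverse_left op_inverse_right)
  have WfW: "W (op_fun f T (W x)) = op_fun (\<lambda>t. p t * f t) T x" if f: "continuous_on {m..M} f" for f x
  proof -
    have "W o\<^sub>L (op_fun f T o\<^sub>L W) = op_fun (\<lambda>t. sqrt (p t) * (f t * sqrt (p t))) T"
      unfolding W_def by (simp add: op_fun_mult[OF T] f sp continuous_on_mult)
    also have "\<dots> = op_fun (\<lambda>t. p t * f t) T"
      by (intro op_fun_cong[OF T]) (use p(2) in \<open>force simp: real_sqrt_mult_self\<close>)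
    finally show ?thesis
      by (metis blinfun_apply_blinfun_compose)
  qed
  have WW: "W (W x) = op_fun p T x" for x
    using WfW[of "\<lambda>_. 1" x] op_fun_const[OF T, of 1] by simp
  define S where "S = V' o\<^sub>L R o\<^sub>L W"
  define S' where "S' = W o\<^sub>L R o\<^sub>L V'"
  have SS': "S o\<^sub>L S' = id_blinfun"
  proof (rule blinfun_eqI)
    fix x
    have "(S o\<^sub>L S') x = V' (X (V' x))"
      by (simp add: S_def S'_def WW X_def)
    then show "(S o\<^sub>L S') x = id_blinfun x"
      by (simp add: inv flip: VV)
  qed
  have "S' o\<^sub>L S = (W' o\<^sub>L R' o\<^sub>L V) o\<^sub>L (S o\<^sub>L S') o\<^sub>L S"
    by (rule blinfun_eqI) (simp add: S_def inv)
  also have "\<dots> = id_blinfun"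
    unfolding SS' by (rule blinfun_eqI) (simp add: S_def inv)
  finally have S'S: "S' o\<^sub>L S = id_blinfun" .
  have qp: "continuous_on {m..M} (\<lambda>t. q t / p t)" "\<And>t. m \<le> t \<Longrightarrow> t \<le> M \<Longrightarrow> 0 < q t / p t"
    using p(2) q(2) by (auto intro!: continuous_intros p(1) q(1) less_imp_neq[THEN not_sym])
  have N: "S o\<^sub>L Q o\<^sub>L S' = V' o\<^sub>L Y o\<^sub>L V'"
  proof (rule blinfun_eqI)
    fix x
    have "(S o\<^sub>L Q o\<^sub>L S') x = V' (R (op_fun (\<lambda>t. p t * (q t / p t)) T (R (V' x))))"
      by (simp add: S_def S'_def Q_def WfW[OF qp(1)])
    also have "op_fun (\<lambda>t. p t * (q t / p t)) T = op_fun q T"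
      using p(2) by (intro op_fun_cong[OF T]) force
    finally show "(S o\<^sub>L Q o\<^sub>L S') x = (V' o\<^sub>L Y o\<^sub>L V') x"
      by (simp add: Y_def)
  qed
  have "V' \<in> positive_invertible_ops"
    unfolding V'_def by (rule positive_invertible_inverse[OF V])
  then have "S o\<^sub>L Q o\<^sub>L S' \<in> positive_invertible_ops"
    unfolding N by (intro positive_invertible_congruence Y) (auto simp: positive_invertibleD)
  then obtain c1 d1 where 1: "0 < c1" "op_between c1 (S o\<^sub>L Q o\<^sub>L S') d1"
    by (auto simp: positive_invertible_between)
  obtain c2 d2 where 2: "0 < c2" "\<And>t. m \<le> t \<Longrightarrow> t \<le> M \<Longrightarrow> c2 \<le> q t / p t \<and> q t / p t \<le> d2"
    using continuous_pos_bounds[OF qp] by blast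
  define c d where "c = min c1 c2" and "d = max d1 d2"
  have c: "0 < c" and bounds: "\<And>t. m \<le> t \<Longrightarrow> t \<le> M \<Longrightarrow> c \<le> q t / p t \<and> q t / p t \<le> d"
    using 1(1) 2 by (force simp: c_def d_def)+
  have hcd: "continuous_on {c..d} h"
    by (rule continuous_on_subset[OF h]) (use c in auto)
  have hqp: "continuous_on {m..M} (\<lambda>t. h (q t / p t))"
    by (rule continuous_on_compose2[OF h qp(1)]) (use qp(2) in auto)
  have "op_fun h (V' o\<^sub>L Y o\<^sub>L V') = S o\<^sub>L op_fun h Q o\<^sub>L S'"
    unfolding N[symmetric]
  proof (rule op_fun_similarity[OF _ hcd _ S'S SS'])
    show "op_between c Q d"
      unfolding Q_def by (rule op_between_op_fun[OF T qp(1) bounds])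
    show "op_between c (S o\<^sub>L Q o\<^sub>L S') d"
      by (rule op_between_mono[OF 1(2)]) (auto simp: c_def d_def)
  qed
  also have "op_fun h Q = op_fun (\<lambda>t. h (q t / p t)) T"
    unfolding Q_def by (rule op_fun_compose[OF T qp(1) bounds hcd])
  finally have "kubo_ando h X Y = V o\<^sub>L (S o\<^sub>L op_fun (\<lambda>t. h (q t / p t)) T o\<^sub>L S') o\<^sub>L V"
    by (simp add: kubo_ando_def Let_def V'_def V_def)
  also have "\<dots> = R o\<^sub>L op_fun (\<lambda>t. p t * h (q t / p t)) T o\<^sub>L R"
    by (rule blinfun_eqI) (simp add: S_def S'_def inv WfW[OF hqp])
  finally show ?thesis
    by (simp add: X_def Y_def)
qed

text \<open>Any two positive invertible operators \<open>A\<close>, \<open>B\<close> have this form, with \<open>R = A\<^sup>1\<^sup>/\<^sup>2\<close>,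
  \<open>T = A\<^sup>-\<^sup>1\<^sup>/\<^sup>2 B A\<^sup>-\<^sup>1\<^sup>/\<^sup>2\<close>, \<open>p = 1\<close> and \<open>q(t) = t\<close>.\<close>

lemma pair_normal_form:
  assumes A: "A \<in> positive_invertible_ops" and B: "B \<in> positive_invertible_ops"
  obtains R T m M where "R \<in> positive_invertible_ops" "0 < m" "op_between m T M"
    "A = R o\<^sub>L R" "B = R o\<^sub>L T o\<^sub>L R"
proof -
  define R where "R = op_fun sqrt A"
  define R' where "R' = op_inverse R"
  have R: "R \<in> positive_invertible_ops" "R o\<^sub>L R = A"
    using sqrt_positive_invertible[OF A] by (auto simp: R_def)
  then have R': "R' \<in> positive_invertible_ops"
    by (simp add: R'_def positive_invertible_inverse)
  have "R' o\<^sub>L B o\<^sub>L R' \<in> positive_invertible_ops"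
    by (intro positive_invertible_congruence B) (use R' in \<open>auto simp: positive_invertibleD\<close>)
  moreover have "B = R o\<^sub>L (R' o\<^sub>L B o\<^sub>L R') o\<^sub>L R"
    using positive_invertible_invertible[OF R(1)]
    by (intro blinfun_eqI) (simp add: R'_def op_inverse_left op_inverse_right)
  ultimately show ?thesis
    using that R by (metis positive_invertible_between)
qed

context
  fixes R T :: "'a::complex_hilbert_space \<Rightarrow>\<^sub>L 'a" and m M :: real
  assumes R: "R \<in> positive_invertible_ops" and m: "0 < m" and T: "op_between m T M"
begin

lemma op_fun_one: "op_fun (\<lambda>t. 1) T = id_blinfun"
  using op_fun_const[OF T, of 1] by simp

lemma kubo_ando_normal_form:
  assumes "continuous_on {0<..} h"
  shows "kubo_ando h (R o\<^sub>L R) (R o\<^sub>L T o\<^sub>L R) = R o\<^sub>L op_fun h T o\<^sub>L R"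
proof -
  have "R o\<^sub>L id_blinfun o\<^sub>L R = R o\<^sub>L R"
    by (rule blinfun_eqI) simp
  then show ?thesis
    using kubo_ando_congruence[of R m T M "\<lambda>_. 1" "\<lambda>t. t" h] assms R m T
    by (simp add: positive_invertibleD op_fun_one op_fun_id[OF T])
qed

lemma arithmetic_mean_normal_form:
  "arithmetic_mean (R o\<^sub>L R) (R o\<^sub>L T o\<^sub>L R) = R o\<^sub>L op_fun (\<lambda>t. (1 + t) / 2) T o\<^sub>L R"
proof -
  have "op_fun (\<lambda>t. (1 / 2) * (1 + t)) T = (1 / 2) *\<^sub>R (id_blinfun + T)"
    unfolding op_fun_scaleR[OF T continuous_on_add[OF continuous_on_const continuous_on_id]]
    by (simp add: op_fun_add[OF T] op_fun_one op_fun_id[OF T])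
  then show ?thesis
    by (intro blinfun_eqI) (simp add: arithmetic_mean_def blinfun.bilinear_simps)
qed

lemma inverse_normal_form:
  assumes f: "continuous_on {m..M} f" "\<And>t. m \<le> t \<Longrightarrow> t \<le> M \<Longrightarrow> 0 < f t"
  shows "op_inverse (R o\<^sub>L op_fun f T o\<^sub>L R) =
    op_inverse R o\<^sub>L op_fun (\<lambda>t. 1 / f t) T o\<^sub>L op_inverse R"
proof -
  have "op_fun f T \<in> positive_invertible_ops"
    by (rule op_fun_positive_invertible[OF T f])
  moreover have "op_inverse (op_fun f T) = op_fun (\<lambda>t. 1 / f t) T"
    using f(2) by (intro op_fun_inverse[OF T f(1)]) force
  ultimately show ?thesis
    using R by (simp add: op_inverse_congruence positive_invertibleD)
qed

lemma inverse_normal_form_pair: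
  "op_inverse (R o\<^sub>L R) = op_inverse R o\<^sub>L op_fun (\<lambda>t. 1) T o\<^sub>L op_inverse R"
  "op_inverse (R o\<^sub>L T o\<^sub>L R) = op_inverse R o\<^sub>L op_fun (\<lambda>t. 1 / t) T o\<^sub>L op_inverse R"
proof -
  have "R o\<^sub>L id_blinfun o\<^sub>L R = R o\<^sub>L R"
    by (rule blinfun_eqI) simp
  then show "op_inverse (R o\<^sub>L R) = op_inverse R o\<^sub>L op_fun (\<lambda>t. 1) T o\<^sub>L op_inverse R"
    using inverse_normal_form[of "\<lambda>_. 1"] by (simp add: op_fun_one)
  show "op_inverse (R o\<^sub>L T o\<^sub>L R) = op_inverse R o\<^sub>L op_fun (\<lambda>t. 1 / t) T o\<^sub>L op_inverse R"
    using inverse_normal_form[of "\<lambda>t. t"] m by (simp add: op_fun_id[OF T])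
qed

end

text \<open>The variable \<open>R\<close> is fixed anew because the previous lemmas are applied to \<open>R\<^sup>-\<^sup>1\<close> as well.\<close>

context
  fixes R T :: "'a::complex_hilbert_space \<Rightarrow>\<^sub>L 'a" and m M :: real
  assumes R: "R \<in> positive_invertible_ops" and m: "0 < m" and T: "op_between m T M"
begin

lemma inverse_inverse_normal_form:
  assumes f: "continuous_on {m..M} f" "\<And>t. m \<le> t \<Longrightarrow> t \<le> M \<Longrightarrow> 0 < f t"
  shows "op_inverse (op_inverse R o\<^sub>L op_fun f T o\<^sub>L op_inverse R) =
    R o\<^sub>L op_fun (\<lambda>t. 1 / f t) T o\<^sub>L R"
  using inverse_normal_form[OF positive_invertible_inverse[OF R] m T f] R
  by (simp add: op_inverse_op_inverse)

lemma harmonic_mean_normal_form: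
  "harmonic_mean (R o\<^sub>L R) (R o\<^sub>L T o\<^sub>L R) = R o\<^sub>L op_fun (\<lambda>t. 2 * t / (1 + t)) T o\<^sub>L R"
proof -
  define f where "f t = (1 / 2) * (1 + 1 / t)" for t :: real
  have c: "continuous_on {m..M} (\<lambda>t. 1 / t)" "continuous_on {m..M} (\<lambda>t. 1 + 1 / t)"
    "continuous_on {m..M} f"
    unfolding f_def using m by (auto intro!: continuous_intros)
  have "op_fun f T = (1 / 2) *\<^sub>R (op_fun (\<lambda>t. 1) T + op_fun (\<lambda>t. 1 / t) T)"
    unfolding f_def op_fun_scaleR[OF T c(2)]
    by (simp add: op_fun_add[OF T _ c(1)])
  then have "(1 / 2) *\<^sub>R (op_inverse (R o\<^sub>L R) + op_inverse (R o\<^sub>L T o\<^sub>L R)) =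
      op_inverse R o\<^sub>L op_fun f T o\<^sub>L op_inverse R"
    unfolding inverse_normal_form_pair[OF R m T]
    by (intro blinfun_eqI) (simp add: blinfun.bilinear_simps)
  then have "harmonic_mean (R o\<^sub>L R) (R o\<^sub>L T o\<^sub>L R) = R o\<^sub>L op_fun (\<lambda>t. 1 / f t) T o\<^sub>L R"
    unfolding harmonic_mean_def using m
    by (simp add: inverse_inverse_normal_form[OF c(3)] f_def add_pos_pos)
  also have "op_fun (\<lambda>t. 1 / f t) T = op_fun (\<lambda>t. 2 * t / (1 + t)) T"
    using m by (intro op_fun_cong[OF T]) (simp add: f_def field_simps)
  finally show ?thesis .
qed

text \<open>Inversion turns the mean of \<open>h\<close> into the mean of its adjoint \<open>t \<mapsto> 1 / h(1/t)\<close>.\<close>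

lemma kubo_ando_inverse_normal_form:
  assumes h: "continuous_on {0<..} h" "\<And>t. 0 < t \<Longrightarrow> 0 < h t"
  shows "kubo_ando h (op_inverse (R o\<^sub>L R)) (op_inverse (R o\<^sub>L T o\<^sub>L R)) =
    op_inverse (kubo_ando (\<lambda>t. 1 / h (1 / t)) (R o\<^sub>L R) (R o\<^sub>L T o\<^sub>L R))"
proof -
  have c: "continuous_on {0<..} (\<lambda>t. 1 / h (1 / t))"
    using h(2) by (intro continuous_intros continuous_on_compose2[OF h(1)]) (auto simp: less_le)
  have R': "op_inverse R \<in> positive_invertible_ops"
    by (rule positive_invertible_inverse[OF R])
  have "kubo_ando h (op_inverse (R o\<^sub>L R)) (op_inverse (R o\<^sub>L T o\<^sub>L R)) =
      op_inverse R o\<^sub>L op_fun (\<lambda>t. h (1 / t)) T o\<^sub>L op_inverse R"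
    unfolding inverse_normal_form_pair[OF R m T]
    using kubo_ando_congruence[OF positive_invertibleD[OF R'] T, of "\<lambda>_. 1" "\<lambda>t. 1 / t" h] m h(1)
    by (simp add: continuous_intros)
  moreover have "op_inverse (kubo_ando (\<lambda>t. 1 / h (1 / t)) (R o\<^sub>L R) (R o\<^sub>L T o\<^sub>L R)) =
      op_inverse R o\<^sub>L op_fun (\<lambda>t. 1 / (1 / h (1 / t))) T o\<^sub>L op_inverse R"
    unfolding kubo_ando_normal_form[OF R m T c]
    by (rule inverse_normal_form[OF R m T continuous_on_subset[OF c]]) (use m h(2) in auto)
  ultimately show ?thesis
    by simp
qed

end

lemma kubo_ando_inverse:
  assumes "A \<in> positive_invertible_ops" "B \<in> positive_invertible_ops"
    and "continuous_on {0<..} h" "\<And>t. 0 < t \<Longrightarrow> 0 < h t"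
  shows "kubo_ando h (op_inverse A) (op_inverse B) = op_inverse (kubo_ando (\<lambda>t. 1 / h (1 / t)) A B)"
  using pair_normal_form[OF assms(1,2)] kubo_ando_inverse_normal_form[OF _ _ _ assms(3,4)] by metis

lemma kubo_ando_positive_invertible:
  assumes A: "A \<in> positive_invertible_ops" and B: "B \<in> positive_invertible_ops"
    and h: "continuous_on {0<..} h" "\<And>t. 0 < t \<Longrightarrow> 0 < h t"
  shows "kubo_ando h A B \<in> positive_invertible_ops"
proof -
  obtain R T m M where *: "R \<in> positive_invertible_ops" "0 < m" "op_between m T M"
    "A = R o\<^sub>L R" "B = R o\<^sub>L T o\<^sub>L R"
    using pair_normal_form[OF A B] .
  have "op_fun h T \<in> positive_invertible_ops"
    by (rule op_fun_positive_invertible[OF *(3) continuous_on_subset[OF h(1)]]) (use *(2) h(2) in auto)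
  then show ?thesis
    using * by (simp add: kubo_ando_normal_form[OF *(1-3) h(1)] positive_invertible_congruence positive_invertibleD)
qed

text \<open>The inverse is operator decreasing because
  \<open>\<langle>x, A\<^sup>-\<^sup>1 x\<rangle> = sup\<^sub>y (2 \<langle>x, y\<rangle> - \<langle>y, Ay\<rangle>)\<close>, attained at \<open>y = A\<^sup>-\<^sup>1 x\<close>.\<close>

lemma op_inverse_antimono:
  assumes A: "A \<in> positive_invertible_ops" and B: "B \<in> positive_invertible_ops" and le: "B \<preceq> A"
  shows "op_inverse A \<preceq> op_inverse B"
proof -
  have sa: "self_adjoint A" "self_adjoint B" "self_adjoint (op_inverse A)" "self_adjoint (op_inverse B)"
    using A B by (auto intro: positive_invertibleD positive_invertible_inverse)
  have "x \<bullet> op_inverse A x \<le> x \<bullet> op_inverse B x" for x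
  proof -
    define y z where "y = op_inverse A x" and "z = op_inverse B x"
    have yz: "A y = x" "B z = x"
      using A B by (auto simp: y_def z_def op_inverse_right positive_invertibleD)
    have "0 \<le> (y - z) \<bullet> B (y - z)"
      using positive_invertible_imp_positive[OF B] positive_ops_iff by blast
    also have "\<dots> = y \<bullet> B y - 2 * (x \<bullet> y) + x \<bullet> z"
      using self_adjointD[OF sa(2), of z y]
      by (simp add: blinfun.bilinear_simps inner_simps yz inner_commute)
    also have "y \<bullet> B y \<le> y \<bullet> A y"
      using le loewner_le_iff[OF sa(2,1)] by blast
    also have "y \<bullet> A y = x \<bullet> y"
      by (simp add: yz inner_commute)
    finally show ?thesis
      by (simp add: y_def z_def)
  qed
  then show ?thesis
    using loewner_le_iff[OF sa(3,4)] by blast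
qed

section \<open>Operator monotone functions are concave\<close>

lemma cinner_diff_right: "cinner x (y - z) = cinner x y - cinner x (z :: 'a::complex_hilbert_space)"
  using cinner_add_right[of x "y - z" z] by simp

lemma cinner_diff_left: "cinner (x - y) z = cinner x z - cinner y (z :: 'a::complex_hilbert_space)"
  using cinner_add_left[of "x - y" y z] by simp

lemma cinner_scaleR_right:
  "cinner x (r *\<^sub>R y) = of_real r * cinner x (y :: 'a::complex_hilbert_space)"
  by (metis scaleC_of_real cinner_scaleC_right)

lemma cinner_scaleR_left:
  "cinner (r *\<^sub>R x) y = of_real r * cinner x (y :: 'a::complex_hilbert_space)"
  by (metis scaleC_of_real cinner_scaleC_left complex_cnj_complex_of_real)

lemma cmod_cinner_le: "cmod (cinner x y) \<le> norm x * norm (y :: 'a::complex_hilbert_space)"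
proof (cases "cinner x y = 0")
  case False
  define c where "c = cnj (cinner x y) / cmod (cinner x y)"
  have c: "cmod c = 1" "c * cinner x y = cmod (cinner x y)"
    using False complex_norm_square[of "cinner x y"]
    by (auto simp: c_def norm_divide field_simps power2_eq_square)
  have "cmod (cinner x y) = x \<bullet> (c *\<^sub>C y)"
    using c(2) by (metis Re_cinner Re_complex_of_real cinner_scaleC_right)
  also have "\<dots> \<le> norm x * norm (c *\<^sub>C y)"
    by (rule norm_cauchy_schwarz)
  finally show ?thesis
    by (simp add: norm_scaleC c)
qed simp

text \<open>For a unit vector \<open>v\<close> this is the orthogonal projection onto \<open>\<complex> v\<close>.\<close>

definition rank_one :: "'a \<Rightarrow> 'a::complex_hilbert_space \<Rightarrow>\<^sub>L 'a" where
  "rank_one v = Blinfun (\<lambda>x. cinner v x *\<^sub>C v)"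

lemma rank_one_apply:
  fixes v x :: "'a::complex_hilbert_space"
  shows "blinfun_apply (rank_one v) x = cinner v x *\<^sub>C v"
proof -
  have "bounded_linear (\<lambda>x :: 'a. cinner v x *\<^sub>C v)"
  proof (rule bounded_linear_intro)
    show "norm (cinner v x *\<^sub>C v) \<le> norm x * (norm v * norm v)" for x
      using mult_right_mono[OF cmod_cinner_le[of v x] norm_ge_zero[of v]]
      by (simp add: norm_scaleC algebra_simps)
    show "cinner v (r *\<^sub>R x) *\<^sub>C v = r *\<^sub>R (cinner v x *\<^sub>C v)" for r x
      unfolding cinner_scaleR_right by (metis scaleC_scaleC scaleC_of_real)
  qed (simp add: cinner_add_right scaleC_add_left)
  then show ?thesis
    by (simp add: rank_one_def bounded_linear_Blinfun_apply)
qed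

lemma inner_rank_one:
  fixes v x :: "'a::complex_hilbert_space"
  shows "x \<bullet> blinfun_apply (rank_one v) x = (cmod (cinner v x))\<^sup>2"
proof -
  have "cinner x (blinfun_apply (rank_one v) x) = cinner v x * cnj (cinner v x)"
    by (simp add: rank_one_apply cinner_scaleC_right flip: cinner_commute)
  then show ?thesis
    by (metis Re_cinner Re_complex_of_real complex_norm_square)
qed

lemma rank_one_positive: "rank_one v \<in> positive_ops"
proof -
  have "rank_one v \<in> bounded_ops"
    by (rule bounded_opsI) (simp add: rank_one_apply cinner_scaleC_right scaleC_scaleC)
  moreover have "cinner x (blinfun_apply (rank_one v) x) = of_real ((cmod (cinner v x))\<^sup>2)" for x
    unfolding complex_norm_square
    by (simp add: rank_one_apply cinner_scaleC_right flip: cinner_commute)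
  ultimately show ?thesis
    by (simp add: positive_ops_def)
qed

lemma op_between_rank_one_perturbation:
  fixes v :: "'a::complex_hilbert_space"
  assumes v: "cinner v v = 1" and r: "0 \<le> r"
  shows "op_between a (a *\<^sub>R id_blinfun + r *\<^sub>R rank_one v) (a + r)"
  unfolding op_between_def
proof (intro conjI allI)
  show "self_adjoint (a *\<^sub>R id_blinfun + r *\<^sub>R rank_one v)"
    using rank_one_positive[of v]
    by (intro self_adjoint_add self_adjoint_scaleR) (auto simp: positive_ops_iff)
  fix x
  have "v \<bullet> v = 1"
    using v by (simp add: cinner_self)
  then have "norm v = 1"
    by (simp add: norm_eq_sqrt_inner)
  then have le: "(cmod (cinner v x))\<^sup>2 \<le> x \<bullet> x"
    using power_mono[OF cmod_cinner_le[of v x], of 2] by (simp add: power2_norm_eq_inner)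
  have "r * (cmod (cinner v x))\<^sup>2 \<le> r * (x \<bullet> x)" "0 \<le> r * (cmod (cinner v x))\<^sup>2"
    using r by (simp_all add: mult_left_mono[OF le])
  moreover have "x \<bullet> (a *\<^sub>R id_blinfun + r *\<^sub>R rank_one v) x = a * (x \<bullet> x) + r * (cmod (cinner v x))\<^sup>2"
    by (simp add: blinfun.bilinear_simps inner_add_right inner_rank_one)
  ultimately show "a * (x \<bullet> x) \<le> x \<bullet> (a *\<^sub>R id_blinfun + r *\<^sub>R rank_one v) x"
    and "x \<bullet> (a *\<^sub>R id_blinfun + r *\<^sub>R rank_one v) x \<le> (a + r) * (x \<bullet> x)"
    by (simp_all add: distrib_right)
qed

lemma bessel_two:
  fixes e1 e2 x :: "'a::complex_hilbert_space"
  assumes e: "cinner e1 e1 = 1" "cinner e2 e2 = 1" "cinner e1 e2 = 0"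
  shows "(cmod (cinner e1 x))\<^sup>2 + (cmod (cinner e2 x))\<^sup>2 \<le> x \<bullet> x"
proof -
  define y where "y = x - cinner e1 x *\<^sub>C e1 - cinner e2 x *\<^sub>C e2"
  have e21: "cinner e2 e1 = 0"
    using e(3) by (metis cinner_commute complex_cnj_zero)
  have y: "cinner e1 y = 0" "cinner e2 y = 0"
    by (simp_all add: y_def cinner_diff_right cinner_scaleC_right e e21)
  then have "cinner y e1 = 0" "cinner y e2 = 0"
    by (metis cinner_commute complex_cnj_zero)+
  then have "cinner y y = cinner y x"
    by (simp add: cinner_diff_right cinner_scaleC_right y_def[THEN arg_cong, of "cinner y"])
  also have "\<dots> = cinner x x - cnj (cinner e1 x) * cinner e1 x - cnj (cinner e2 x) * cinner e2 x"
    by (simp add: y_def cinner_diff_left cinner_scaleC_left)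
  also have "\<dots> = of_real (x \<bullet> x - (cmod (cinner e1 x))\<^sup>2 - (cmod (cinner e2 x))\<^sup>2)"
    unfolding of_real_diff complex_norm_square cinner_self by (simp add: mult.commute)
  finally have "y \<bullet> y = x \<bullet> x - (cmod (cinner e1 x))\<^sup>2 - (cmod (cinner e2 x))\<^sup>2"
    unfolding cinner_self of_real_eq_iff .
  then show ?thesis
    using inner_ge_zero[of y] by linarith
qed

lemma infinite_dimensional_orthonormal_pair:
  assumes "infinite_dimensional TYPE('a::complex_hilbert_space)"
  obtains e1 e2 :: "'a::complex_hilbert_space" where "cinner e1 e1 = 1" "cinner e2 e2 = 1" "cinner e1 e2 = 0"
proof -
  have span: "complex_vector.span B \<noteq> (UNIV :: 'a set)" if "finite B" for B
    using assms that by (auto simp: infinite_dimensional_def)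
  have unit: "cinner (x /\<^sub>R norm x) (x /\<^sub>R norm x) = 1" if "x \<noteq> 0" for x :: 'a
    using that by (simp add: cinner_self dot_square_norm power2_eq_square)
  obtain x :: 'a where x: "x \<noteq> 0"
    using span[of "{}"] by auto
  define e1 where "e1 = x /\<^sub>R norm x"
  have e1: "cinner e1 e1 = 1"
    unfolding e1_def by (rule unit[OF x])
  obtain y where y: "y \<notin> complex_vector.span {e1}"
    using span[of "{e1}"] by auto
  define z where "z = y - cinner e1 y *\<^sub>C e1"
  have "z \<noteq> 0"
    using y complex_vector.span_scale[OF complex_vector.span_base, of e1 "{e1}" "cinner e1 y"]
    by (auto simp: z_def)
  then have "cinner (z /\<^sub>R norm z) (z /\<^sub>R norm z) = 1"
    by (rule unit)
  moreover have "cinner e1 (z /\<^sub>R norm z) = 0"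
    by (simp add: cinner_scaleR_right z_def cinner_diff_right cinner_scaleC_right e1)
  ultimately show ?thesis
    using that e1 by blast
qed

lemma operator_monotoneD:
  assumes "operator_monotone TYPE('a::complex_hilbert_space) h"
    and "A \<in> positive_invertible_ops" "B \<in> (positive_invertible_ops :: ('a \<Rightarrow>\<^sub>L 'a) set)" "B \<preceq> A"
  shows "op_fun h B \<preceq> op_fun h A"
  using assms by (auto simp: operator_monotone_def)

text \<open>The function \<open>h\<close> is applied to an operator \<open>X\<close> with eigenvalues \<open>b\<close> at
  \<open>v = t\<^sup>1\<^sup>/\<^sup>2 e1 + (1 - t)\<^sup>1\<^sup>/\<^sup>2 e2\<close> and \<open>a\<close> on the orthogonal complement of \<open>v\<close>.  Its diagonal entry at \<open>e1\<close> is
  \<open>c = (1 - t) a + t b\<close>, and that of \<open>h(X)\<close> is \<open>(1 - t) h(a) + t h(b)\<close>.  For each \<open>\<epsilon> > 0\<close> and large \<open>K\<close>, the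
  operator \<open>Y = (c + \<epsilon>) + K P\<close> with \<open>P\<close> the projection onto \<open>e2\<close> dominates \<open>X\<close>, while \<open>h(Y)\<close> has
  the diagonal entry \<open>h(c + \<epsilon>)\<close> at \<open>e1\<close>.\<close>

lemma operator_monotone_concave:
  assumes dim: "infinite_dimensional TYPE('a::complex_hilbert_space)"
    and h: "operator_monotone TYPE('a) h"
  shows "concave_on {0<..} h"
proof (rule concave_on_linorderI)
  fix t a b :: real
  assume t: "0 < t" "t < 1" and ab: "a \<in> {0<..}" "b \<in> {0<..}" "a < b"
  obtain e1 e2 :: 'a where e: "cinner e1 e1 = 1" "cinner e2 e2 = 1" "cinner e1 e2 = 0"
    using infinite_dimensional_orthonormal_pair[OF dim] .
  then have e': "cinner e2 e1 = 0" "e1 \<bullet> e1 = 1" "e1 \<bullet> e2 = 0"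
    by (auto simp: simp flip: Re_cinner) (metis cinner_commute complex_cnj_zero)
  define r s where "r = sqrt t" and "s = sqrt (1 - t)"
  have rs: "r * r = t" "s * s = 1 - t" "0 \<le> r" "0 \<le> s"
    using t by (auto simp: r_def s_def)
  define v w where "v = r *\<^sub>R e1 + s *\<^sub>R e2" and "w = s *\<^sub>R e1 - r *\<^sub>R e2"
  have vv: "cinner v v = 1" and ww: "cinner w w = 1" and vw: "cinner v w = 0"
    using rs(1,2)
    by (simp_all add: v_def w_def cinner_add_left cinner_add_right cinner_diff_left
        cinner_diff_right cinner_scaleR_left cinner_scaleR_right e e' flip: of_real_mult of_real_add)
  have e1: "e1 = r *\<^sub>R v + s *\<^sub>R w"
    using rs(1,2) by (simp add: v_def w_def algebra_simps flip: scaleR_add_left)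
  have e1v: "e1 \<bullet> v = r" "e1 \<bullet> w = s"
    by (simp_all add: v_def w_def inner_simps e')
  define d where "d = b - a"
  define c where "c = (1 - t) * a + t * b"
  have "c > 0"
    unfolding c_def using ab t by (intro add_pos_pos mult_pos_pos) auto
  then have d: "d > 0" and c: "c > 0" "c = a + t * d"
    using ab by (auto simp: d_def c_def algebra_simps)
  have cont: "continuous_on {0<..} h"
    using h by (simp add: operator_monotone_def)
  have h_cont: "continuous_on {u..z} h" if "0 < u" for u z
    by (rule continuous_on_subset[OF cont]) (use that in auto)
  define X where "X = a *\<^sub>R id_blinfun + d *\<^sub>R rank_one v"
  have X: "op_between a X b"
    using op_between_rank_one_perturbation[OF vv, of d a] d by (simp add: X_def d_def)
  have "X v = b *\<^sub>R v" "X w = a *\<^sub>R w"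
    using scaleC_of_real[of 1 v] scaleC_of_real[of 0 v]
    by (simp_all add: X_def d_def blinfun.bilinear_simps rank_one_apply vv vw algebra_simps)
  moreover have "v \<noteq> 0" "w \<noteq> 0"
    using vv ww by (auto simp: cinner_self)
  ultimately have hX: "op_fun h X v = h b *\<^sub>R v" "op_fun h X w = h a *\<^sub>R w"
    using ab op_fun_eigenvector[OF X h_cont] by auto
  have diag_X: "e1 \<bullet> op_fun h X e1 = (1 - t) * h a + t * h b"
  proof -
    have "op_fun h X e1 = (r * h b) *\<^sub>R v + (s * h a) *\<^sub>R w"
      by (subst e1) (simp add: blinfun.bilinear_simps hX)
    then have "e1 \<bullet> op_fun h X e1 = (s * s) * h a + (r * r) * h b"
      by (simp add: inner_simps e1v)
    then show ?thesis
      by (simp only: rs)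
  qed
  have le: "(1 - t) * h a + t * h b \<le> h (c + \<epsilon>)" if \<epsilon>: "\<epsilon> > 0" for \<epsilon>
  proof -
    \<comment> \<open>In the estimate of \<open>\<langle>x, Xx\<rangle>\<close> below, \<open>\<epsilon> x1\<^sup>2 + (d\<^sup>2/\<epsilon>) x2\<^sup>2\<close> absorbs the cross term \<open>2 d x1 x2\<close>.\<close>
    define K where "K = d + d\<^sup>2 / \<epsilon>"
    have K: "K > 0"
      using d \<epsilon> by (simp add: K_def add_pos_pos)
    define Y where "Y = (c + \<epsilon>) *\<^sub>R id_blinfun + K *\<^sub>R rank_one e2"
    have Y: "op_between (c + \<epsilon>) Y (c + \<epsilon> + K)"
      unfolding Y_def using K by (intro op_between_rank_one_perturbation e) auto
    have Y_e1: "Y e1 = (c + \<epsilon>) *\<^sub>R e1"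
      using scaleC_of_real[of 0 e2] by (simp add: Y_def blinfun.bilinear_simps rank_one_apply e')
    have "e1 \<noteq> 0"
      using e'(2) by auto
    have "0 < c + \<epsilon>"
      using c(1) \<epsilon> by simp
    then have "op_fun h Y e1 = h (c + \<epsilon>) *\<^sub>R e1"
      using op_fun_eigenvector[OF Y h_cont Y_e1] \<open>e1 \<noteq> 0\<close> by blast
    then have diag_Y: "e1 \<bullet> op_fun h Y e1 = h (c + \<epsilon>)"
      using e'(2) by simp
    have "x \<bullet> X x \<le> x \<bullet> Y x" for x
    proof -
      define x1 x2 where "x1 = cmod (cinner e1 x)" and "x2 = cmod (cinner e2 x)"
      have bessel: "(t * d + \<epsilon>) * (x1\<^sup>2 + x2\<^sup>2) \<le> (t * d + \<epsilon>) * (x \<bullet> x)"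
        unfolding x1_def x2_def using bessel_two[OF e] t d \<epsilon> by (intro mult_left_mono) auto
      have "cmod (cinner v x) \<le> r * x1 + s * x2"
        using norm_triangle_ineq[of "of_real r * cinner e1 x" "of_real s * cinner e2 x"] rs(3,4)
        by (simp add: v_def cinner_add_left cinner_scaleR_left norm_mult x1_def x2_def)
      then have "(cmod (cinner v x))\<^sup>2 \<le> (r * x1 + s * x2)\<^sup>2"
        by (intro power_mono) auto
      then have "d * (cmod (cinner v x))\<^sup>2 \<le> d * (r * x1 + s * x2)\<^sup>2"
        using d by (intro mult_left_mono) auto
      also have "(r * x1 + s * x2)\<^sup>2 = r * r * x1\<^sup>2 + s * s * x2\<^sup>2 + 2 * r * s * x1 * x2"
        by (simp add: power2_eq_square algebra_simps)
      also have "2 * r * s * x1 * x2 \<le> 2 * x1 * x2"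
      proof -
        have "r \<le> 1" "s \<le> 1"
          using t by (auto simp: r_def s_def)
        then have "r * s \<le> 1"
          using rs(3,4) by (simp add: mult_le_one)
        then have "(r * s) * (2 * x1 * x2) \<le> 1 * (2 * x1 * x2)"
          by (intro mult_right_mono) (auto simp: x1_def x2_def)
        then show ?thesis by (simp add: algebra_simps)
      qed
      finally have v: "d * (cmod (cinner v x))\<^sup>2 \<le> d * t * x1\<^sup>2 + d * (1 - t) * x2\<^sup>2 + 2 * d * x1 * x2"
        using d unfolding rs(1,2) by (simp add: algebra_simps)
      have "0 \<le> (\<epsilon> * x1 - d * x2)\<^sup>2 / \<epsilon>"
        using \<epsilon> by simp
      also have "\<dots> = \<epsilon> * x1\<^sup>2 - 2 * d * x1 * x2 + d\<^sup>2 / \<epsilon> * x2\<^sup>2"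
        using \<epsilon> by (simp add: field_simps power2_eq_square)
      finally have "2 * d * x1 * x2 \<le> \<epsilon> * x1\<^sup>2 + d\<^sup>2 / \<epsilon> * x2\<^sup>2"
        by simp
      moreover have "0 \<le> 2 * t * d * x2\<^sup>2 + \<epsilon> * x2\<^sup>2"
        using t d \<epsilon> by simp
      ultimately have "d * (cmod (cinner v x))\<^sup>2 \<le> (t * d + \<epsilon>) * (x1\<^sup>2 + x2\<^sup>2) + K * x2\<^sup>2"
        using v by (simp add: K_def algebra_simps)
      with bessel have "d * (cmod (cinner v x))\<^sup>2 \<le> (t * d + \<epsilon>) * (x \<bullet> x) + K * x2\<^sup>2"
        by linarith
      then show ?thesis
        by (simp add: X_def Y_def blinfun.bilinear_simps inner_simps inner_rank_one c(2) x2_def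
            algebra_simps)
    qed
    then have "X \<preceq> Y"
      using loewner_le_iff op_between_self_adjoint[OF X] op_between_self_adjoint[OF Y] by blast
    moreover have "X \<in> positive_invertible_ops" "Y \<in> positive_invertible_ops"
      unfolding positive_invertible_between using X Y ab(1) \<open>0 < c + \<epsilon>\<close> by auto
    ultimately have "op_fun h X \<preceq> op_fun h Y"
      using operator_monotoneD[OF h] by blast
    moreover have "self_adjoint (op_fun h X)" "self_adjoint (op_fun h Y)"
      using ab c \<epsilon> by (intro self_adjoint_op_fun[OF X] self_adjoint_op_fun[OF Y] h_cont; simp)+
    ultimately have "e1 \<bullet> op_fun h X e1 \<le> e1 \<bullet> op_fun h Y e1"
      using loewner_le_iff by blast
    then show ?thesis
      by (simp add: diag_X diag_Y)
  qed
  have "isCont h c"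
    using cont c(1) by (simp add: continuous_on_eq_continuous_at)
  then have "((\<lambda>\<epsilon>. h (c + \<epsilon>)) \<longlongrightarrow> h c) (at_right 0)"
    by (auto simp: isCont_def LIM_offset_zero_iff intro: tendsto_within_subset)
  then have "(1 - t) * h a + t * h b \<le> h c"
    by (rule tendsto_lowerbound) (use le eventually_at_right_less[of "0 :: real"] in
        \<open>auto elim: eventually_mono\<close>)
  then show "h ((1 - t) *\<^sub>R a + t *\<^sub>R b) \<ge> (1 - t) * h a + t * h b"
    by (simp add: c_def)
qed simp

section \<open>Comparison of nearby operators\<close>

lemma concave_perspective:
  fixes h :: "real \<Rightarrow> real"
  assumes h: "concave_on {0<..} h"
  shows "concave_on {-1<..<1} (\<lambda>z. (1 - z) * h ((1 + z) / (1 - z)))"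
  unfolding concave_on_iff
proof (intro conjI ballI allI impI)
  fix x y u v :: real
  assume x: "x \<in> {-1<..<1}" and y: "y \<in> {-1<..<1}" and u: "0 \<le> u" "0 \<le> v" "u + v = 1"
  define z where "z = u * x + v * y"
  have uv: "1 - z = u * (1 - x) + v * (1 - y)" "1 + z = u * (1 + x) + v * (1 + y)"
    using u(3) by (auto simp: z_def algebra_simps)
  have "u > 0 \<or> v > 0"
    using u by linarith
  then have pos: "1 - z > 0"
    unfolding uv using x y u by (auto intro: add_pos_nonneg add_nonneg_pos)
  define a b where "a = u * (1 - x) / (1 - z)" and "b = v * (1 - y) / (1 - z)"
  have ab: "0 \<le> a" "0 \<le> b" "a + b = 1"
    using x y u pos by (auto simp: a_def b_def uv(1) add_divide_distrib[symmetric])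
  have "a * ((1 + x) / (1 - x)) = u * (1 + x) / (1 - z)" "b * ((1 + y) / (1 - y)) = v * (1 + y) / (1 - z)"
    using x y by (simp_all add: a_def b_def)
  then have "a * ((1 + x) / (1 - x)) + b * ((1 + y) / (1 - y)) = (1 + z) / (1 - z)"
    by (simp only: uv(2) add_divide_distrib)
  moreover have "a * h p + b * h q \<le> h (a * p + b * q)" if "0 < p" "0 < q" for p q
    using h that ab by (auto simp: concave_on_iff)
  then have "a * h ((1 + x) / (1 - x)) + b * h ((1 + y) / (1 - y)) \<le>
      h (a * ((1 + x) / (1 - x)) + b * ((1 + y) / (1 - y)))"
    by this (use x y in auto)
  ultimately have "(1 - z) * (a * h ((1 + x) / (1 - x)) + b * h ((1 + y) / (1 - y))) \<le>
      (1 - z) * h ((1 + z) / (1 - z))"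
    using pos by simp
  moreover have "(1 - z) * a = u * (1 - x)" "(1 - z) * b = v * (1 - y)"
    using pos by (simp_all add: a_def b_def)
  ultimately show "(1 - (u *\<^sub>R x + v *\<^sub>R y)) * h ((1 + (u *\<^sub>R x + v *\<^sub>R y)) / (1 - (u *\<^sub>R x + v *\<^sub>R y)))
      \<ge> u * ((1 - x) * h ((1 + x) / (1 - x))) + v * ((1 - y) * h ((1 + y) / (1 - y)))"
    by (simp add: z_def distrib_left flip: mult.assoc)
qed simp

text \<open>The mean of the numbers \<open>1 - z\<close> and \<open>1 + z\<close>, whose arithmetic mean is \<open>1\<close>, is an even concave
  function \<open>k\<close> of \<open>z\<close> with maximum \<open>k(0) = 1\<close>.  If it is not constant, then it decreases strictly from
  \<open>1\<close> beyond the last point \<open>z\<^sub>0\<close> with \<open>k(z\<^sub>0) = 1\<close>.  Its continuous inverse \<open>\<zeta>\<close> there writes each number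
  \<open>s\<close> close enough to \<open>1\<close> as the mean of \<open>1 - \<zeta>(s)\<close> and \<open>1 + \<zeta>(s)\<close>.\<close>

lemma mean_section:
  fixes h :: "real \<Rightarrow> real"
  assumes concave: "concave_on {0<..} h" and cont: "continuous_on {0<..} h"
    and pos: "\<And>t. 0 < t \<Longrightarrow> 0 < h t" and sym: "\<And>t. 0 < t \<Longrightarrow> h t = t * h (1 / t)"
    and one: "h 1 = 1" and t0: "0 < t0" "h t0 \<noteq> (1 + t0) / 2"
  obtains c \<zeta> where "0 < c" "c < 1" "continuous_on {c..1} \<zeta>"
    "\<And>s. c \<le> s \<Longrightarrow> s \<le> 1 \<Longrightarrow> 0 \<le> \<zeta> s \<and> \<zeta> s < 1 \<and> (1 - \<zeta> s) * h ((1 + \<zeta> s) / (1 - \<zeta> s)) = s"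
proof -
  define k where "k z = (1 - z) * h ((1 + z) / (1 - z))" for z
  have conc: "concave_on {-1<..<1} k"
    using concave_perspective[OF concave] by (simp add: k_def[abs_def])
  have concD: "u * k x + v * k y \<le> k (u * x + v * y)"
    if "\<bar>x\<bar> < 1" "\<bar>y\<bar> < 1" "0 \<le> u" "0 \<le> v" "u + v = 1" for x y u v
    using conc that by (auto simp: concave_on_iff abs_less_iff)
  have even: "k (- z) = k z" if "\<bar>z\<bar> < 1" for z
  proof -
    have "0 < (1 - z) / (1 + z)"
      using that by (auto simp: abs_less_iff)
    from sym[OF this] show ?thesis
      using that by (simp add: k_def abs_less_iff)
  qed
  have k0: "k 0 = 1"
    by (simp add: k_def one)
  have le_1: "k z \<le> 1" if "\<bar>z\<bar> < 1" for z
    using concD[of z "- z" "1 / 2" "1 / 2"] even[OF that] k0 that by simp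
  define z1 where "z1 = \<bar>(t0 - 1) / (t0 + 1)\<bar>"
  have z1: "0 \<le> z1" "z1 < 1"
    using t0(1) by (auto simp: z1_def abs_if field_simps)
  have "k z1 < 1"
  proof -
    define w where "w = (t0 - 1) / (t0 + 1)"
    have w: "\<bar>w\<bar> < 1"
      using z1 by (simp add: z1_def w_def)
    have "1 - w = 2 / (t0 + 1)" "1 + w = 2 * t0 / (t0 + 1)"
      using t0(1) by (auto simp: w_def field_simps)
    then have "k w = 2 * h t0 / (t0 + 1)"
      using t0(1) by (simp add: k_def)
    then have "k w \<noteq> 1"
      using t0 by (auto simp: field_simps)
    moreover have "k z1 = k w"
      using even[OF w] by (auto simp: z1_def w_def[symmetric] abs_if)
    ultimately show ?thesis
      using le_1[OF w] by simp
  qed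
  have k_pos: "k z1 > 0"
    unfolding k_def using z1 by (intro mult_pos_pos pos) auto
  have cont_k: "continuous_on {0..z1} k"
  proof -
    have "continuous_on {0..z1} (\<lambda>z. (1 + z) / (1 - z))"
      using z1 by (intro continuous_intros) auto
    then have "continuous_on {0..z1} (\<lambda>z. h ((1 + z) / (1 - z)))"
      by (rule continuous_on_compose2[OF cont]) (use z1 in auto)
    then show ?thesis
      unfolding k_def by (intro continuous_on_mult continuous_on_diff continuous_on_const continuous_on_id)
  qed
  define Z where "Z = {z \<in> {0..z1}. k z = 1}"
  have "closed Z"
    unfolding Z_def by (rule continuous_closed_preimage_constant[OF cont_k closed_atLeastAtMost])
  moreover have "bounded Z"
    by (rule bounded_subset[OF bounded_closed_interval[of 0 z1]]) (auto simp: Z_def)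
  ultimately have "compact Z"
    by (simp add: compact_eq_bounded_closed)
  moreover have "Z \<noteq> {}"
    using z1 k0 by (auto simp: Z_def)
  ultimately obtain z0 where z0: "z0 \<in> Z" "\<And>z. z \<in> Z \<Longrightarrow> z \<le> z0"
    using compact_attains_sup by metis
  then have z01: "0 \<le> z0" "z0 \<le> z1" "k z0 = 1"
    by (auto simp: Z_def)
  have strict: "k b < k a" if "z0 \<le> a" "a < b" "b \<le> z1" for a b
  proof -
    have "b \<notin> Z"
      using z0(2)[of b] that by auto
    then have b: "k b < 1"
      using le_1[of b] that z01 z1 by (force simp: Z_def)
    define l where "l = (a - z0) / (b - z0)"
    have l: "0 \<le> l" "l < 1" "l * (b - z0) = a - z0"
      using that by (auto simp: l_def)
    then have a: "a = (1 - l) * z0 + l * b"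
      by (simp add: algebra_simps)
    have "(1 - l) * k z0 + l * k b \<le> k ((1 - l) * z0 + l * b)"
      using that z01 z1 l(1,2) by (intro concD) auto
    moreover have "k b < (1 - l) * k z0 + l * k b"
      using mult_strict_left_mono[OF b, of "1 - l"] l by (simp add: z01 algebra_simps)
    ultimately show ?thesis
      by (simp add: a)
  qed
  have inj: "inj_on k {z0..z1}"
    by (rule linorder_inj_onI) (use strict in force)+
  define \<zeta> where "\<zeta> = the_inv_into {z0..z1} k"
  have cont_k': "continuous_on {z0..z1} k"
    by (rule continuous_on_subset[OF cont_k]) (use z01 in auto)
  have "continuous_on (k ` {z0..z1}) \<zeta>"
    unfolding \<zeta>_def by (rule continuous_on_inv[OF cont_k' compact_Icc])
      (simp add: the_inv_into_f_f[OF inj])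
  moreover have range: "{k z1..1} \<subseteq> k ` {z0..z1}"
  proof
    fix s assume "s \<in> {k z1..1}"
    then show "s \<in> k ` {z0..z1}"
      using IVT2'[of k z1 s z0] cont_k' z01 by auto
  qed
  ultimately have "continuous_on {k z1..1} \<zeta>"
    using continuous_on_subset by blast
  moreover have "0 \<le> \<zeta> s \<and> \<zeta> s < 1 \<and> k (\<zeta> s) = s" if "k z1 \<le> s" "s \<le> 1" for s
  proof -
    have "s \<in> k ` {z0..z1}"
      using range that by auto
    then have "\<zeta> s \<in> {z0..z1}" "k (\<zeta> s) = s"
      unfolding \<zeta>_def using the_inv_into_into[OF inj _ order_refl] f_the_inv_into_f[OF inj] by blast+
    then show ?thesis
      using z01 z1 by auto
  qed
  ultimately show ?thesis
    using that[of "k z1" \<zeta>] \<open>k z1 < 1\<close> k_pos by (simp add: k_def)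
qed

lemma loewner_le_refl: "A \<preceq> A"
  using self_adjoint_scaleR[OF self_adjoint_id, of 0] by (simp add: loewner_le_def positive_ops_iff)

lemma loewner_le_trans: "A \<preceq> B \<Longrightarrow> B \<preceq> C \<Longrightarrow> A \<preceq> C"
  using self_adjoint_add[of "B - A" "C - B"]
  by (auto simp: loewner_le_def positive_ops_iff blinfun.bilinear_simps inner_simps)
    (smt (verit))

lemma loewner_le_positive_invertible:
  assumes "A \<in> positive_invertible_ops" "B \<in> positive_invertible_ops"
  shows "A \<preceq> B \<longleftrightarrow> (\<forall>x. x \<bullet> A x \<le> x \<bullet> B x)"
  using assms by (simp add: loewner_le_iff positive_invertibleD)

text \<open>If \<open>cA \<le> B \<le> A\<close>, then \<open>A = RR\<close> and \<open>B = RTR\<close> with \<open>c \<le> T \<le> 1\<close>, and \<open>A\<close> and \<open>B\<close> are the arithmetic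
  mean and the \<open>h\<close>-mean of the same pair \<open>R(1 - \<zeta>(T))R\<close>, \<open>R(1 + \<zeta>(T))R\<close>.\<close>

lemma common_pair_of_nearby_operators:
  fixes A B :: "'a::complex_hilbert_space \<Rightarrow>\<^sub>L 'a"
  assumes h: "continuous_on {0<..} h"
    and c: "0 < c" "continuous_on {c..1} \<zeta>"
    and \<zeta>: "\<And>s. c \<le> s \<Longrightarrow> s \<le> 1 \<Longrightarrow> 0 \<le> \<zeta> s \<and> \<zeta> s < 1 \<and> (1 - \<zeta> s) * h ((1 + \<zeta> s) / (1 - \<zeta> s)) = s"
    and A: "A \<in> positive_invertible_ops" and B: "B \<in> positive_invertible_ops"
    and le: "c *\<^sub>R A \<preceq> B" "B \<preceq> A"
  obtains X Y where "X \<in> positive_invertible_ops" "Y \<in> positive_invertible_ops"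
    "A = arithmetic_mean X Y" "B = kubo_ando h X Y"
proof -
  obtain R T m M where R: "R \<in> positive_invertible_ops" and T: "op_between m T M"
    and AB: "A = R o\<^sub>L R" "B = R o\<^sub>L T o\<^sub>L R"
    using pair_normal_form[OF A B] .
  note R' = positive_invertibleD[OF R]
  have "op_between c T 1"
    unfolding op_between_def
  proof (intro conjI allI)
    show "self_adjoint T"
      by (rule op_between_self_adjoint[OF T])
    fix x
    define y where "y = op_inverse R x"
    have y: "R y = x"
      by (simp add: y_def op_inverse_right R')
    have "y \<bullet> A y = x \<bullet> x" "y \<bullet> B y = x \<bullet> T x"
      using self_adjointD[OF R'(1), of y] by (simp_all add: AB y)
    moreover have "y \<bullet> (c *\<^sub>R A) y \<le> y \<bullet> B y" "y \<bullet> B y \<le> y \<bullet> A y"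
      using le A B c(1) by (simp_all add: loewner_le_positive_invertible positive_invertible_scaleR)
    ultimately show "c * (x \<bullet> x) \<le> x \<bullet> T x" "x \<bullet> T x \<le> 1 * (x \<bullet> x)"
      by (simp_all add: blinfun.bilinear_simps)
  qed
  note T = this
  define p q where "p s = 1 - \<zeta> s" and "q s = 1 + \<zeta> s" for s
  have p: "continuous_on {c..1} p" and p0: "\<And>s. c \<le> s \<Longrightarrow> s \<le> 1 \<Longrightarrow> 0 < p s"
    and q: "continuous_on {c..1} q" and q0: "\<And>s. c \<le> s \<Longrightarrow> s \<le> 1 \<Longrightarrow> 0 < q s"
    unfolding p_def q_def using \<zeta> by (auto intro!: continuous_intros c add_pos_nonneg)
  define X Y where "X = R o\<^sub>L op_fun p T o\<^sub>L R" and "Y = R o\<^sub>L op_fun q T o\<^sub>L R"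
  have "op_fun p T + op_fun q T = op_fun (\<lambda>s. p s + q s) T"
    by (rule op_fun_add[OF T p q, symmetric])
  also have "\<dots> = 2 *\<^sub>R id_blinfun"
    using op_fun_const[OF T, of 2] by (simp add: p_def q_def)
  finally have pq: "op_fun p T x + op_fun q T x = 2 *\<^sub>R x" for x
    by (metis blinfun.add_left blinfun.scaleR_left blinfun_apply_id_blinfun)
  have "A = arithmetic_mean X Y"
  proof (rule blinfun_eqI)
    fix x
    have "arithmetic_mean X Y x = (1 / 2) *\<^sub>R R (op_fun p T (R x) + op_fun q T (R x))"
      by (simp add: arithmetic_mean_def X_def Y_def blinfun.bilinear_simps)
    then show "A x = arithmetic_mean X Y x"
      by (simp add: pq AB blinfun.bilinear_simps)
  qed
  moreover have "kubo_ando h X Y = R o\<^sub>L op_fun (\<lambda>s. p s * h (q s / p s)) T o\<^sub>L R"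
    unfolding X_def Y_def by (rule kubo_ando_congruence[OF R' T p p0 q q0 h])
  moreover have "op_fun (\<lambda>s. p s * h (q s / p s)) T = op_fun (\<lambda>s. s) T"
    using \<zeta> by (intro op_fun_cong[OF T]) (simp add: p_def q_def)
  ultimately show ?thesis
    using that[of X Y] AB op_fun_id[OF T]
    by (simp add: X_def Y_def positive_invertible_congruence[OF R']
        op_fun_positive_invertible[OF T p p0] op_fun_positive_invertible[OF T q q0])
qed

text \<open>Operators \<open>B \<le> A\<close> are joined by the segment \<open>B + (j/n)(A - B)\<close>.  Its steps are at most \<open>M/n\<close>, where
  \<open>A \<le> M\<close>, while its points are at least \<open>b > 0\<close>, where \<open>B \<ge> b\<close>; for large \<open>n\<close> consecutive points
  are within the factor \<open>c\<close>.\<close>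

lemma monotone_of_monotone_nearby:
  fixes F :: "('a::complex_hilbert_space \<Rightarrow>\<^sub>L 'a) \<Rightarrow> ('a \<Rightarrow>\<^sub>L 'a)"
  assumes c: "c < 1"
    and near: "\<And>A B. A \<in> positive_invertible_ops \<Longrightarrow> B \<in> positive_invertible_ops \<Longrightarrow>
      c *\<^sub>R A \<preceq> B \<Longrightarrow> B \<preceq> A \<Longrightarrow> F B \<preceq> F A"
    and A: "A \<in> positive_invertible_ops" and B: "B \<in> positive_invertible_ops" and le: "B \<preceq> A"
  shows "F B \<preceq> F A"
proof -
  obtain M m' where M: "op_between m' A M"
    using A positive_invertible_between by blast
  obtain b M' where b: "0 < b" "op_between b B M'"
    using B positive_invertible_between by blast
  obtain n where n: "M / ((1 - c) * b) < real n" "n > 0"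
    using reals_Archimedean2 by (metis less_trans of_nat_0_less_iff max_less_iff_conj)
  have n': "M / real n \<le> (1 - c) * b"
    using n b(1) c by (simp add: field_simps)
  define D where "D = A - B"
  have D: "0 \<le> x \<bullet> D x" "x \<bullet> D x \<le> M * (x \<bullet> x)" for x
  proof -
    have eq: "x \<bullet> D x = x \<bullet> A x - x \<bullet> B x"
      by (simp add: D_def blinfun.bilinear_simps inner_diff_right)
    show "0 \<le> x \<bullet> D x"
      using le loewner_le_positive_invertible[OF B A] eq by simp
    have "0 \<le> x \<bullet> B x"
      using positive_invertible_imp_positive[OF B] positive_ops_iff by blast
    then show "x \<bullet> D x \<le> M * (x \<bullet> x)"
      using op_between_upper[OF M, of x] eq by simp
  qed
  have Dsa: "self_adjoint D"
    unfolding D_def using A B by (intro self_adjoint_diff positive_invertibleD)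
  define P where "P j = B + (real j / n) *\<^sub>R D" for j
  have P: "P j \<in> positive_invertible_ops" for j
    unfolding P_def
    by (intro positive_invertible_add B)
      (simp add: positive_ops_iff self_adjoint_scaleR Dsa blinfun.bilinear_simps D)
  have P_apply: "x \<bullet> P j x = x \<bullet> B x + real j / real n * (x \<bullet> D x)" for x j
    by (simp add: P_def blinfun.bilinear_simps inner_simps)
  have step: "F (P j) \<preceq> F (P (Suc j))" for j
  proof (rule near[OF P P])
    have "x \<bullet> P j x \<le> x \<bullet> P (Suc j) x" for x
      using D(1)[of x] by (simp add: P_apply divide_right_mono mult_right_mono)
    then show "P j \<preceq> P (Suc j)"
      by (simp add: loewner_le_positive_invertible P)
    have "x \<bullet> (c *\<^sub>R P (Suc j)) x \<le> x \<bullet> P j x" for x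
    proof -
      have "1 / real n * (x \<bullet> D x) \<le> M / real n * (x \<bullet> x)"
        using D(2)[of x] by (simp add: divide_right_mono)
      also have "\<dots> \<le> (1 - c) * b * (x \<bullet> x)"
        using n' by (rule mult_right_mono) simp
      also have "\<dots> \<le> (1 - c) * (x \<bullet> B x)"
        using op_between_lower[OF b(2), of x] c by (simp add: mult.assoc mult_left_mono)
      also have "\<dots> \<le> (1 - c) * (x \<bullet> P (Suc j) x)"
        using D(1)[of x] c by (intro mult_left_mono) (auto simp: P_apply)
      finally have "1 / real n * (x \<bullet> D x) \<le> x \<bullet> P (Suc j) x - c * (x \<bullet> P (Suc j) x)"
        by (simp add: left_diff_distrib)
      moreover have "x \<bullet> P (Suc j) x = x \<bullet> P j x + 1 / real n * (x \<bullet> D x)"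
        by (simp add: P_apply add_divide_distrib distrib_right)
      ultimately have "c * (x \<bullet> P (Suc j) x) \<le> x \<bullet> P j x"
        by linarith
      then show ?thesis
        by (simp add: blinfun.scaleR_left)
    qed
    moreover have "self_adjoint (c *\<^sub>R P (Suc j))" "self_adjoint (P j)"
      using P by (auto intro: self_adjoint_scaleR positive_invertibleD)
    ultimately show "c *\<^sub>R P (Suc j) \<preceq> P j"
      using loewner_le_iff by blast
  qed
  have "F (P 0) \<preceq> F (P j)" for j
    by (induction j) (use step loewner_le_refl loewner_le_trans in blast)+
  moreover have "P 0 = B" "P n = A"
    using n(2) by (simp_all add: P_def D_def)
  ultimately show ?thesis
    by metis
qed

lemma operator_monotone_if_mean_le_arithmetic:
  fixes f h :: "real \<Rightarrow> real"
  assumes f: "continuous_on {0<..} f"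
    and concave: "concave_on {0<..} h" and cont: "continuous_on {0<..} h"
    and pos: "\<And>t. 0 < t \<Longrightarrow> 0 < h t" and sym: "\<And>t. 0 < t \<Longrightarrow> h t = t * h (1 / t)"
    and one: "h 1 = 1" and t0: "0 < t0" "h t0 \<noteq> (1 + t0) / 2"
    and ineq: "\<And>A B :: 'a::complex_hilbert_space \<Rightarrow>\<^sub>L 'a.
      A \<in> positive_invertible_ops \<Longrightarrow> B \<in> positive_invertible_ops \<Longrightarrow>
      op_fun f (kubo_ando h A B) \<preceq> op_fun f (arithmetic_mean A B)"
  shows "operator_monotone TYPE('a) f"
proof -
  obtain c \<zeta> where c: "0 < c" "c < 1" "continuous_on {c..1} \<zeta>"
    and \<zeta>: "\<And>s. c \<le> s \<Longrightarrow> s \<le> 1 \<Longrightarrow>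
      0 \<le> \<zeta> s \<and> \<zeta> s < 1 \<and> (1 - \<zeta> s) * h ((1 + \<zeta> s) / (1 - \<zeta> s)) = s"
    using mean_section[OF concave cont pos sym one t0] by blast
  have near: "op_fun f B \<preceq> op_fun f A"
    if "A \<in> positive_invertible_ops" "B \<in> positive_invertible_ops" "c *\<^sub>R A \<preceq> B" "B \<preceq> A"
    for A B :: "'a \<Rightarrow>\<^sub>L 'a"
    using common_pair_of_nearby_operators[OF cont c(1,3) \<zeta> that] ineq by metis
  show ?thesis
    unfolding operator_monotone_def
    using f monotone_of_monotone_nearby[where F = "op_fun f", OF c(2) near] by blast
qed

section \<open>The functions of symmetric means\<close>

lemma op_fun_scalar:
  "op_fun f (a *\<^sub>R (id_blinfun :: 'a::complex_hilbert_space \<Rightarrow>\<^sub>L 'a)) = f a *\<^sub>R id_blinfun"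
proof -
  have T: "op_between a (a *\<^sub>R (id_blinfun :: 'a \<Rightarrow>\<^sub>L 'a)) a"
    by (simp add: op_between_def self_adjoint_scaleR blinfun.bilinear_simps)
  have "op_fun f (a *\<^sub>R (id_blinfun :: 'a \<Rightarrow>\<^sub>L 'a)) = op_fun (\<lambda>_. f a) (a *\<^sub>R id_blinfun)"
    by (rule op_fun_cong[OF T]) (metis order_antisym)
  then show ?thesis
    by (simp add: op_fun_const[OF T])
qed

lemma kubo_ando_scalars:
  assumes "0 < a" "0 < b" "continuous_on {0<..} h"
  shows "kubo_ando h (a *\<^sub>R (id_blinfun :: 'a::complex_hilbert_space \<Rightarrow>\<^sub>L 'a)) (b *\<^sub>R id_blinfun) =
    (a * h (b / a)) *\<^sub>R id_blinfun"
proof -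
  have "id_blinfun o\<^sub>L A o\<^sub>L id_blinfun = A" for A :: "'a \<Rightarrow>\<^sub>L 'a"
    by (rule blinfun_eqI) simp
  then show ?thesis
    using kubo_ando_congruence[of "id_blinfun :: 'a \<Rightarrow>\<^sub>L 'a" 1 id_blinfun 1 "\<lambda>_. a" "\<lambda>_. b" h] assms
    by (simp add: op_fun_const[OF op_between_id] positive_invertible_invertible)
qed

lemma operator_monotone_imp_mono:
  assumes h: "operator_monotone TYPE('a::complex_hilbert_space) h"
    and ab: "0 < a" "a \<le> b" and x: "x \<noteq> (0 :: 'a)"
  shows "h a \<le> h b"
proof -
  define S where "S r = r *\<^sub>R (id_blinfun :: 'a \<Rightarrow>\<^sub>L 'a)" for r
  have sa: "self_adjoint (S r)" and S: "x \<bullet> S r x = r * (x \<bullet> x)" for r x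
    by (simp_all add: S_def self_adjoint_scaleR blinfun.bilinear_simps)
  have "S a \<preceq> S b"
    using ab(2) by (simp add: loewner_le_iff sa S mult_right_mono)
  then have "op_fun h (S a) \<preceq> op_fun h (S b)"
    using ab by (intro operator_monotoneD[OF h]) (auto simp: S_def positive_invertible_scaleR)
  then have "S (h a) \<preceq> S (h b)"
    by (simp add: S_def op_fun_scalar)
  then have "h a * (x \<bullet> x) \<le> h b * (x \<bullet> x)"
    by (simp add: loewner_le_iff sa S)
  then show ?thesis
    using x by simp
qed

lemma operator_monotone_closed_imp:
  "operator_monotone_closed TYPE('a::complex_hilbert_space) h \<Longrightarrow> operator_monotone TYPE('a) h"
  unfolding operator_monotone_closed_def operator_monotone_def
  using continuous_on_subset[of "{0..}" h "{0<..}"] positive_invertible_imp_positive by fastforce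

text \<open>On the scalar operators \<open>1\<close> and \<open>t\<close> symmetry reads \<open>h(t) = t h(1/t)\<close>.  As \<open>h\<close> increases and
  \<open>h(1) = 1\<close>, it is positive on \<open>[1, \<infinity>)\<close>, and by this equation also on \<open>(0, 1)\<close>.\<close>

lemma symmetric_mean_function:
  fixes \<sigma> :: "'a::complex_hilbert_space binop"
  assumes \<sigma>: "symmetric_mean \<sigma>" and x: "x \<noteq> (0 :: 'a)"
  obtains h where "operator_monotone TYPE('a) h" "continuous_on {0<..} h"
    "\<And>t. 0 < t \<Longrightarrow> 0 < h t" "\<And>t. 0 < t \<Longrightarrow> h t = t * h (1 / t)" "h 1 = 1"
    "\<And>A B. A \<in> positive_invertible_ops \<Longrightarrow> B \<in> positive_invertible_ops \<Longrightarrow> \<sigma> A B = kubo_ando h A B"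
proof -
  obtain h where h: "operator_monotone_closed TYPE('a) h" "h 1 = 1"
    "\<And>A B. A \<in> positive_invertible_ops \<Longrightarrow> B \<in> positive_invertible_ops \<Longrightarrow> \<sigma> A B = kubo_ando h A B"
    using \<sigma> by (auto simp: symmetric_mean_def operator_mean_def)
  have mono: "operator_monotone TYPE('a) h"
    using h(1) by (rule operator_monotone_closed_imp)
  then have cont: "continuous_on {0<..} h"
    by (simp add: operator_monotone_def)
  have sym: "h t = t * h (1 / t)" if t: "0 < t" for t
  proof -
    have piv: "r *\<^sub>R (id_blinfun :: 'a \<Rightarrow>\<^sub>L 'a) \<in> positive_invertible_ops" if "0 < r" for r
      using that by (simp add: positive_invertible_scaleR)
    have "kubo_ando h (1 *\<^sub>R id_blinfun) (t *\<^sub>R id_blinfun) =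
        kubo_ando h (t *\<^sub>R id_blinfun) (1 *\<^sub>R (id_blinfun :: 'a \<Rightarrow>\<^sub>L 'a))"
      using \<sigma> h(3) piv[of 1] piv[OF t] unfolding symmetric_mean_def by (metis zero_less_one)
    then have "h t *\<^sub>R (id_blinfun :: 'a \<Rightarrow>\<^sub>L 'a) = (t * h (1 / t)) *\<^sub>R id_blinfun"
      unfolding kubo_ando_scalars[OF zero_less_one t cont] kubo_ando_scalars[OF t zero_less_one cont]
      by simp
    then have "h t *\<^sub>R x = (t * h (1 / t)) *\<^sub>R x"
      by (metis blinfun.scaleR_left blinfun_apply_id_blinfun)
    then show ?thesis
      using x by (simp only: scaleR_cancel_right) simp
  qed
  have pos: "0 < h t" if t: "0 < t" for t
  proof (cases "1 \<le> t")
    case True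
    then show ?thesis
      using operator_monotone_imp_mono[OF mono zero_less_one True x] h(2) by simp
  next
    case False
    then have "1 \<le> h (1 / t)"
      using operator_monotone_imp_mono[OF mono zero_less_one _ x, of "1 / t"] h(2) t by simp
    then show ?thesis
      using sym[OF t] t by simp
  qed
  show ?thesis
    using that[OF mono cont pos sym h(2,3)] .
qed

lemma op_fun_of_inverse:
  assumes A: "A \<in> positive_invertible_ops" and f: "continuous_on {0<..} f"
  shows "op_fun f (op_inverse A) = op_fun (\<lambda>t. f (1 / t)) A"
proof -
  obtain m M where m: "0 < m" and A: "op_between m A M"
    using A positive_invertible_between by blast
  have g: "continuous_on {m..M} (\<lambda>t. 1 / t)" "\<And>t. m \<le> t \<Longrightarrow> t \<le> M \<Longrightarrow> 0 < 1 / t"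
    using m by (auto intro!: continuous_intros)
  obtain c d where c: "0 < c" "\<And>t. m \<le> t \<Longrightarrow> t \<le> M \<Longrightarrow> c \<le> 1 / t \<and> 1 / t \<le> d"
    using continuous_pos_bounds[OF g] by blast
  have "continuous_on {c..d} f"
    by (rule continuous_on_subset[OF f]) (use c(1) in auto)
  then show ?thesis
    using op_fun_compose[OF A g(1) c(2)] op_inverse_eq_op_fun[OF A m] by simp
qed

lemma op_inverse_op_fun:
  assumes A: "A \<in> positive_invertible_ops" and f: "continuous_on {0<..} f" "\<And>t. 0 < t \<Longrightarrow> 0 < f t"
  shows "op_inverse (op_fun f A) = op_fun (\<lambda>t. 1 / f t) A" "op_fun f A \<in> positive_invertible_ops"
proof -
  obtain m M where m: "0 < m" and A: "op_between m A M"
    using A positive_invertible_between by blast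
  have "continuous_on {m..M} f" "\<And>t. m \<le> t \<Longrightarrow> 0 < f t"
    using m f(2) by (auto intro: continuous_on_subset[OF f(1)])
  then show "op_inverse (op_fun f A) = op_fun (\<lambda>t. 1 / f t) A" "op_fun f A \<in> positive_invertible_ops"
    by (force intro: op_fun_inverse[OF A] op_fun_positive_invertible[OF A])+
qed

lemma op_fun_uminus_pos:
  assumes "A \<in> positive_invertible_ops" "continuous_on {0<..} f"
  shows "op_fun (\<lambda>t. - f t) A = - op_fun f A"
proof -
  obtain m M where m: "0 < m" and A: "op_between m A M"
    using assms(1) positive_invertible_between by blast
  show ?thesis
    by (rule op_fun_uminus[OF A continuous_on_subset[OF assms(2)]]) (use m in auto)
qed

lemma op_fun_uminus_le_iff:
  assumes "A \<in> positive_invertible_ops" "B \<in> positive_invertible_ops" "continuous_on {0<..} f"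
  shows "op_fun (\<lambda>t. - f t) A \<preceq> op_fun (\<lambda>t. - f t) B \<longleftrightarrow> op_fun f B \<preceq> op_fun f A"
  using assms by (simp add: op_fun_uminus_pos loewner_le_def)

lemma continuous_on_inverse_arg:
  fixes f :: "real \<Rightarrow> real"
  shows "continuous_on {0<..} f \<Longrightarrow> continuous_on {0<..} (\<lambda>t. f (1 / t))"
  by (rule continuous_on_compose2[of "{0<..}" f]) (auto intro!: continuous_intros)

text \<open>The two inversions each reverse the order, so the adjoint of \<open>h\<close> is operator monotone again; hence it is
  concave as well, which is what the case of the harmonic mean uses.\<close>

lemma operator_monotone_adjoint:
  assumes h: "operator_monotone TYPE('a::complex_hilbert_space) h" and pos: "\<And>t. 0 < t \<Longrightarrow> 0 < h t"
  shows "operator_monotone TYPE('a) (\<lambda>t. 1 / h (1 / t))"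
  unfolding operator_monotone_def
proof (intro conjI ballI impI)
  have cont: "continuous_on {0<..} h"
    using h by (simp add: operator_monotone_def)
  note cont' = continuous_on_inverse_arg[OF cont]
  show "continuous_on {0<..} (\<lambda>t. 1 / h (1 / t))"
    using pos by (intro continuous_intros cont') (auto simp: less_le)
  fix A B :: "'a \<Rightarrow>\<^sub>L 'a"
  assume A: "A \<in> positive_invertible_ops" and B: "B \<in> positive_invertible_ops" and le: "B \<preceq> A"
  have "op_fun h (op_inverse A) \<preceq> op_fun h (op_inverse B)"
    by (intro operator_monotoneD[OF h] positive_invertible_inverse op_inverse_antimono A B le)
  then have "op_fun (\<lambda>t. h (1 / t)) A \<preceq> op_fun (\<lambda>t. h (1 / t)) B"
    by (simp add: op_fun_of_inverse A B cont)
  then have "op_inverse (op_fun (\<lambda>t. h (1 / t)) B) \<preceq> op_inverse (op_fun (\<lambda>t. h (1 / t)) A)"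
    using pos by (intro op_inverse_antimono op_inverse_op_fun(2)[OF _ cont'] A B) auto
  then show "op_fun (\<lambda>t. 1 / h (1 / t)) B \<preceq> op_fun (\<lambda>t. 1 / h (1 / t)) A"
    using pos by (simp add: op_inverse_op_fun(1)[OF _ cont'] A B)
qed

lemma arithmetic_mean_positive_invertible:
  "A \<in> positive_invertible_ops \<Longrightarrow> B \<in> positive_invertible_ops \<Longrightarrow>
    arithmetic_mean A B \<in> positive_invertible_ops"
  by (simp add: arithmetic_mean_def positive_invertible_scaleR positive_invertible_add
      positive_invertible_imp_positive)

lemma harmonic_mean_eq: "harmonic_mean A B = op_inverse (arithmetic_mean (op_inverse A) (op_inverse B))"
  by (simp add: harmonic_mean_def arithmetic_mean_def)

lemma harmonic_mean_positive_invertible: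
  "A \<in> positive_invertible_ops \<Longrightarrow> B \<in> positive_invertible_ops \<Longrightarrow>
    harmonic_mean A B \<in> positive_invertible_ops"
  by (simp add: harmonic_mean_eq positive_invertible_inverse arithmetic_mean_positive_invertible)

lemma arithmetic_mean_eq_kubo_ando:
  assumes "A \<in> positive_invertible_ops" "B \<in> positive_invertible_ops"
    and h: "continuous_on {0<..} h" "\<And>t. 0 < t \<Longrightarrow> h t = (1 + t) / 2"
  shows "arithmetic_mean A B = kubo_ando h A B"
proof -
  obtain R T m M where *: "R \<in> positive_invertible_ops" "0 < m" "op_between m T M"
    "A = R o\<^sub>L R" "B = R o\<^sub>L T o\<^sub>L R"
    using pair_normal_form[OF assms(1,2)] .
  have "op_fun h T = op_fun (\<lambda>t. (1 + t) / 2) T"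
    by (rule op_fun_cong[OF *(3)]) (use *(2) h(2) in auto)
  then show ?thesis
    by (simp add: *(4,5) arithmetic_mean_normal_form[OF *(1-3)] kubo_ando_normal_form[OF *(1-3) h(1)])
qed

lemma harmonic_mean_eq_kubo_ando:
  assumes "A \<in> positive_invertible_ops" "B \<in> positive_invertible_ops"
    and h: "continuous_on {0<..} h" "\<And>t. 0 < t \<Longrightarrow> h t = 2 * t / (1 + t)"
  shows "harmonic_mean A B = kubo_ando h A B"
proof -
  obtain R T m M where *: "R \<in> positive_invertible_ops" "0 < m" "op_between m T M"
    "A = R o\<^sub>L R" "B = R o\<^sub>L T o\<^sub>L R"
    using pair_normal_form[OF assms(1,2)] .
  have "op_fun h T = op_fun (\<lambda>t. 2 * t / (1 + t)) T"
    by (rule op_fun_cong[OF *(3)]) (use *(2) h(2) in auto)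
  then show ?thesis
    by (simp add: *(4,5) harmonic_mean_normal_form[OF *(1-3)] kubo_ando_normal_form[OF *(1-3) h(1)])
qed


section \<open>The arithmetic and the harmonic mean as symmetric means\<close>

lemma symmetric_arithmetic_mean: "symmetric_mean (arithmetic_mean :: 'a::complex_hilbert_space binop)"
proof -
  have "operator_monotone_closed TYPE('a) (\<lambda>t. (1 + t) / 2)"
    unfolding operator_monotone_closed_def
  proof (intro conjI ballI impI)
    fix A B :: "'a \<Rightarrow>\<^sub>L 'a" assume AB: "A \<in> positive_ops" "B \<in> positive_ops" "B \<preceq> A"
    have "op_fun (\<lambda>t. (1 + t) / 2) C = (1 / 2) *\<^sub>R (id_blinfun + C)"
      if pos: "C \<in> positive_ops" for C :: "'a \<Rightarrow>\<^sub>L 'a"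
    proof -
      obtain M where C: "op_between 0 C M"
        using pos by (auto simp: positive_ops_between)
      have "op_fun (\<lambda>t. 1 / 2 * (1 + t)) C = (1 / 2) *\<^sub>R (id_blinfun + C)"
        unfolding op_fun_scaleR[OF C continuous_on_add[OF continuous_on_const continuous_on_id]]
        using op_fun_const[OF C, of 1] by (simp add: op_fun_add[OF C] op_fun_id[OF C])
      then show ?thesis by simp
    qed
    moreover have "(1 / 2) *\<^sub>R (A - B) \<in> positive_ops"
      using AB(3) by (simp add: loewner_le_def positive_ops_iff self_adjoint_scaleR blinfun.bilinear_simps)
    ultimately show "op_fun (\<lambda>t. (1 + t) / 2) B \<preceq> op_fun (\<lambda>t. (1 + t) / 2) A"
      using AB(1,2) by (simp add: loewner_le_def flip: scaleR_diff_right)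
  qed (auto intro!: continuous_intros)
  moreover have "arithmetic_mean A B = kubo_ando (\<lambda>t. (1 + t) / 2) A B"
    if "A \<in> positive_invertible_ops" "B \<in> positive_invertible_ops" for A B :: "'a \<Rightarrow>\<^sub>L 'a"
    using that by (intro arithmetic_mean_eq_kubo_ando) (auto intro!: continuous_intros)
  ultimately have "operator_mean (arithmetic_mean :: 'a binop)"
    unfolding operator_mean_def by (intro exI[where x = "\<lambda>t :: real. (1 + t) / 2"]) simp
  then show ?thesis
    by (simp add: symmetric_mean_def arithmetic_mean_def add.commute)
qed

lemma symmetric_harmonic_mean: "symmetric_mean (harmonic_mean :: 'a::complex_hilbert_space binop)"
proof -
  have "operator_monotone_closed TYPE('a) (\<lambda>t. 2 * t / (1 + t))"
    unfolding operator_monotone_closed_def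
  proof (intro conjI ballI impI)
    fix A B :: "'a \<Rightarrow>\<^sub>L 'a" assume A: "A \<in> positive_ops" and B: "B \<in> positive_ops" and le: "B \<preceq> A"
    \<comment> \<open>Here \<open>2t/(1 + t) = 2 - 2/(1 + t)\<close>.\<close>
    have *: "op_fun (\<lambda>t. 2 * t / (1 + t)) C = 2 *\<^sub>R id_blinfun - 2 *\<^sub>R op_inverse (id_blinfun + C)"
      if pos: "C \<in> positive_ops" for C :: "'a \<Rightarrow>\<^sub>L 'a"
    proof -
      obtain M where C: "op_between 0 C M"
        using pos by (auto simp: positive_ops_between)
      have c1: "continuous_on {0..M} (\<lambda>t. 1 + t)"
        by (intro continuous_intros)
      have c2: "continuous_on {0..M} (\<lambda>t. 1 / (1 + t))"
        by (intro continuous_intros) auto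
      have c3: "continuous_on {0..M} (\<lambda>t. 2 * (1 / (1 + t)))"
        by (rule continuous_on_mult[OF continuous_on_const c2])
      have "op_fun (\<lambda>t. 1 + t) C = id_blinfun + C"
        using op_fun_const[OF C, of 1] by (simp add: op_fun_add[OF C] op_fun_id[OF C])
      then have inv: "op_inverse (id_blinfun + C) = op_fun (\<lambda>t. 1 / (1 + t)) C"
        using op_fun_inverse[OF C c1] by simp
      have "op_fun (\<lambda>t. 2 * t / (1 + t)) C = op_fun (\<lambda>t. 2 - 2 * (1 / (1 + t))) C"
        by (rule op_fun_cong[OF C]) (simp add: field_simps)
      also have "\<dots> = 2 *\<^sub>R id_blinfun - 2 *\<^sub>R op_fun (\<lambda>t. 1 / (1 + t)) C"
        unfolding op_fun_diff[OF C continuous_on_const c3] op_fun_scaleR[OF C c2] op_fun_const[OF C] ..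
      finally show ?thesis
        by (simp add: inv)
    qed
    have "id_blinfun + B \<preceq> id_blinfun + A"
      using le by (simp add: loewner_le_def)
    then have "op_inverse (id_blinfun + A) \<preceq> op_inverse (id_blinfun + B)"
      by (intro op_inverse_antimono positive_invertible_add positive_invertible_id A B)
    then have "2 *\<^sub>R (op_inverse (id_blinfun + B) - op_inverse (id_blinfun + A)) \<in> positive_ops"
      by (simp add: loewner_le_def positive_ops_iff self_adjoint_scaleR blinfun.bilinear_simps)
    then show "op_fun (\<lambda>t. 2 * t / (1 + t)) B \<preceq> op_fun (\<lambda>t. 2 * t / (1 + t)) A"
      by (simp add: *[OF A] *[OF B] loewner_le_def scaleR_diff_right)
  qed (auto intro!: continuous_intros)
  moreover have "harmonic_mean A B = kubo_ando (\<lambda>t. 2 * t / (1 + t)) A B"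
    if "A \<in> positive_invertible_ops" "B \<in> positive_invertible_ops" for A B :: "'a \<Rightarrow>\<^sub>L 'a"
    using that by (intro harmonic_mean_eq_kubo_ando) (auto intro!: continuous_intros)
  ultimately have "operator_mean (harmonic_mean :: 'a binop)"
    unfolding operator_mean_def by (intro exI[where x = "\<lambda>t :: real. 2 * t / (1 + t)"]) simp
  then show ?thesis
    by (simp add: symmetric_mean_def harmonic_mean_def add.commute)
qed

lemma distinct_harmonic_arithmetic:
  assumes x: "x \<noteq> (0 :: 'a::complex_hilbert_space)"
  shows "distinct_means harmonic_mean (arithmetic_mean :: 'a binop)"
    and "distinct_means arithmetic_mean (harmonic_mean :: 'a binop)"
proof -
  define A B where "A = 1 *\<^sub>R (id_blinfun :: 'a \<Rightarrow>\<^sub>L 'a)" and "B = 3 *\<^sub>R (id_blinfun :: 'a \<Rightarrow>\<^sub>L 'a)"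
  have AB: "A \<in> positive_invertible_ops" "B \<in> positive_invertible_ops"
    unfolding A_def B_def by (intro positive_invertible_scaleR positive_invertible_id; simp)+
  have cont: "continuous_on {0<..} (\<lambda>t :: real. 2 * t / (1 + t))"
    by (auto intro!: continuous_intros)
  have "harmonic_mean A B = kubo_ando (\<lambda>t. 2 * t / (1 + t)) A B"
    by (rule harmonic_mean_eq_kubo_ando[OF AB cont refl])
  also have "\<dots> = (3 / 2) *\<^sub>R id_blinfun"
    unfolding A_def B_def by (subst kubo_ando_scalars[OF _ _ cont]) auto
  finally have "harmonic_mean A B x = (3 / 2) *\<^sub>R x"
    by (simp add: blinfun.bilinear_simps)
  moreover have "arithmetic_mean A B x = (1 / 2 + 3 / 2) *\<^sub>R x"
    unfolding scaleR_add_left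
    by (simp add: arithmetic_mean_def A_def B_def blinfun.bilinear_simps scaleR_add_right)
  ultimately have "harmonic_mean A B \<noteq> arithmetic_mean A B"
    using x by auto
  then show "distinct_means harmonic_mean (arithmetic_mean :: 'a binop)"
    and "distinct_means arithmetic_mean (harmonic_mean :: 'a binop)"
    unfolding distinct_means_def using AB by metis+
qed

text \<open>In normal form this is the inequality \<open>2t/(1 + t) \<le> (1 + t)/2\<close> for numbers \<open>t > 0\<close>.\<close>

lemma harmonic_le_arithmetic:
  assumes A: "A \<in> positive_invertible_ops" and B: "B \<in> positive_invertible_ops"
  shows "harmonic_mean A B \<preceq> arithmetic_mean A B"
proof -
  obtain R T m M where R: "R \<in> positive_invertible_ops" and m: "0 < m" and T: "op_between m T M"
    and AB: "A = R o\<^sub>L R" "B = R o\<^sub>L T o\<^sub>L R"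
    using pair_normal_form[OF A B] .
  have "x \<bullet> op_fun (\<lambda>t. 2 * t / (1 + t)) T x \<le> x \<bullet> op_fun (\<lambda>t. (1 + t) / 2) T x" for x
  proof (rule op_fun_mono[OF T])
    show "continuous_on {m..M} (\<lambda>t. 2 * t / (1 + t))" "continuous_on {m..M} (\<lambda>t. (1 + t) / 2)"
      using m by (auto intro!: continuous_intros)
    show "2 * t / (1 + t) \<le> (1 + t) / 2" if "m \<le> t" for t
    proof -
      have "4 * t \<le> (1 + t) * (1 + t)"
        using zero_le_square[of "1 - t"] by (simp add: algebra_simps)
      then show ?thesis
        using m that by (simp add: field_simps)
    qed
  qed
  then have "x \<bullet> harmonic_mean A B x \<le> x \<bullet> arithmetic_mean A B x" for x
    unfolding AB harmonic_mean_normal_form[OF R m T] arithmetic_mean_normal_form[OF R m T]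
    using positive_invertible_self_adjoint[OF R] by (simp add: self_adjointD)
  then show ?thesis
    using A B by (simp add: loewner_le_positive_invertible harmonic_mean_positive_invertible
        arithmetic_mean_positive_invertible)
qed


section \<open>The characterizations\<close>

text \<open>An operator monotone function preserves the inequality between the harmonic and the arithmetic mean, so
  \<open>\<sigma>\<close> can be the harmonic mean.  Conversely the function of \<open>\<sigma>\<close> is concave and differs from
  \<open>(1 + t)/2\<close>, as the comparison of nearby operators requires.\<close>

lemma operator_monotone_iff_arithmetic:
  fixes f :: "real \<Rightarrow> real"
  assumes dim: "infinite_dimensional TYPE('a::complex_hilbert_space)" and f: "continuous_on {0<..} f"
  shows "operator_monotone TYPE('a) f \<longleftrightarrow>
    (\<exists>\<sigma> :: 'a binop. symmetric_mean \<sigma> \<and> distinct_means \<sigma> arithmetic_mean \<and>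
      (\<forall>A \<in> positive_invertible_ops. \<forall>B \<in> positive_invertible_ops.
         op_fun f (\<sigma> A B) \<preceq> op_fun f (arithmetic_mean A B)))"
proof -
  obtain x :: 'a where x: "x \<noteq> 0"
    using infinite_dimensional_orthonormal_pair[OF dim] by (metis cinner_self inner_zero_left of_real_0 zero_neq_one)
  show ?thesis
  proof
    assume "operator_monotone TYPE('a) f"
    then show "\<exists>\<sigma> :: 'a binop. symmetric_mean \<sigma> \<and> distinct_means \<sigma> arithmetic_mean \<and>
      (\<forall>A \<in> positive_invertible_ops. \<forall>B \<in> positive_invertible_ops.
         op_fun f (\<sigma> A B) \<preceq> op_fun f (arithmetic_mean A B))"
      by (intro exI[of _ harmonic_mean] conjI ballI symmetric_harmonic_mean
          distinct_harmonic_arithmetic[OF x] operator_monotoneD harmonic_le_arithmetic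
          arithmetic_mean_positive_invertible harmonic_mean_positive_invertible)
  next
    assume "\<exists>\<sigma> :: 'a binop. symmetric_mean \<sigma> \<and> distinct_means \<sigma> arithmetic_mean \<and>
      (\<forall>A \<in> positive_invertible_ops. \<forall>B \<in> positive_invertible_ops.
         op_fun f (\<sigma> A B) \<preceq> op_fun f (arithmetic_mean A B))"
    then obtain \<sigma> :: "'a binop" where \<sigma>: "symmetric_mean \<sigma>" "distinct_means \<sigma> arithmetic_mean"
      and ineq: "\<And>A B. A \<in> positive_invertible_ops \<Longrightarrow> B \<in> positive_invertible_ops \<Longrightarrow>
         op_fun f (\<sigma> A B) \<preceq> op_fun f (arithmetic_mean A B)"
      by blast
    obtain h where h: "operator_monotone TYPE('a) h" "continuous_on {0<..} h"
      "\<And>t. 0 < t \<Longrightarrow> 0 < h t" "\<And>t. 0 < t \<Longrightarrow> h t = t * h (1 / t)" "h 1 = 1"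
      "\<And>A B. A \<in> positive_invertible_ops \<Longrightarrow> B \<in> positive_invertible_ops \<Longrightarrow> \<sigma> A B = kubo_ando h A B"
      using symmetric_mean_function[OF \<sigma>(1) x] by blast
    obtain t0 where "0 < t0" "h t0 \<noteq> (1 + t0) / 2"
      using \<sigma>(2) arithmetic_mean_eq_kubo_ando[OF _ _ h(2)] h(6) unfolding distinct_means_def by metis
    then show "operator_monotone TYPE('a) f"
      using operator_monotone_if_mean_le_arithmetic[OF f operator_monotone_concave[OF dim h(1)] h(2)]
        h(3-6) ineq by metis
  qed
qed

text \<open>Under \<open>A \<mapsto> A\<^sup>-\<^sup>1\<close> the harmonic mean turns into the arithmetic mean and the mean of \<open>h\<close> into that of
  its adjoint, so that \<open>x \<mapsto> - f(1/x)\<close> satisfies the condition for the arithmetic mean.\<close>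

lemma operator_monotone_iff_harmonic:
  fixes f :: "real \<Rightarrow> real"
  assumes dim: "infinite_dimensional TYPE('a::complex_hilbert_space)" and f: "continuous_on {0<..} f"
  shows "operator_monotone TYPE('a) f \<longleftrightarrow>
    (\<exists>\<sigma> :: 'a binop. symmetric_mean \<sigma> \<and> distinct_means \<sigma> harmonic_mean \<and>
      (\<forall>A \<in> positive_invertible_ops. \<forall>B \<in> positive_invertible_ops.
         op_fun f (harmonic_mean A B) \<preceq> op_fun f (\<sigma> A B)))"
proof -
  obtain x :: 'a where x: "x \<noteq> 0"
    using infinite_dimensional_orthonormal_pair[OF dim] by (metis cinner_self inner_zero_left of_real_0 zero_neq_one)
  show ?thesis
  proof
    assume "operator_monotone TYPE('a) f"
    then show "\<exists>\<sigma> :: 'a binop. symmetric_mean \<sigma> \<and> distinct_means \<sigma> harmonic_mean \<and>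
      (\<forall>A \<in> positive_invertible_ops. \<forall>B \<in> positive_invertible_ops.
         op_fun f (harmonic_mean A B) \<preceq> op_fun f (\<sigma> A B))"
      by (intro exI[of _ arithmetic_mean] conjI ballI symmetric_arithmetic_mean
          distinct_harmonic_arithmetic[OF x] operator_monotoneD harmonic_le_arithmetic
          arithmetic_mean_positive_invertible harmonic_mean_positive_invertible)
  next
    assume "\<exists>\<sigma> :: 'a binop. symmetric_mean \<sigma> \<and> distinct_means \<sigma> harmonic_mean \<and>
      (\<forall>A \<in> positive_invertible_ops. \<forall>B \<in> positive_invertible_ops.
         op_fun f (harmonic_mean A B) \<preceq> op_fun f (\<sigma> A B))"
    then obtain \<sigma> :: "'a binop" where \<sigma>: "symmetric_mean \<sigma>" "distinct_means \<sigma> harmonic_mean"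
      and ineq: "\<And>A B. A \<in> positive_invertible_ops \<Longrightarrow> B \<in> positive_invertible_ops \<Longrightarrow>
         op_fun f (harmonic_mean A B) \<preceq> op_fun f (\<sigma> A B)"
      by blast
    obtain h where h: "operator_monotone TYPE('a) h" "continuous_on {0<..} h"
      "\<And>t. 0 < t \<Longrightarrow> 0 < h t" "\<And>t. 0 < t \<Longrightarrow> h t = t * h (1 / t)" "h 1 = 1"
      "\<And>A B. A \<in> positive_invertible_ops \<Longrightarrow> B \<in> positive_invertible_ops \<Longrightarrow> \<sigma> A B = kubo_ando h A B"
      using symmetric_mean_function[OF \<sigma>(1) x] by blast
    define k where "k t = 1 / h (1 / t)" for t
    have k: "operator_monotone TYPE('a) k"
      unfolding k_def[abs_def] by (rule operator_monotone_adjoint[OF h(1,3)])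
    then have k_cont: "continuous_on {0<..} k"
      by (simp add: operator_monotone_def)
    have k_pos: "0 < k t" if "0 < t" for t
      using h(3) that by (simp add: k_def)
    have k_sym: "k t = t * k (1 / t)" if "0 < t" for t
      using h(4)[OF that] that by (simp add: k_def)
    have k_one: "k 1 = 1"
      by (simp add: k_def h(5))
    obtain t1 where t1: "0 < t1" "h t1 \<noteq> 2 * t1 / (1 + t1)"
      using \<sigma>(2) harmonic_mean_eq_kubo_ando[OF _ _ h(2)] h(6) unfolding distinct_means_def by metis
    have t0: "0 < 1 / t1" "k (1 / t1) \<noteq> (1 + 1 / t1) / 2"
      using t1 h(3)[OF t1(1)] by (auto simp: k_def field_simps)
    define g where "g t = - f (1 / t)" for t
    have f': "continuous_on {0<..} (\<lambda>t. f (1 / t))"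
      by (rule continuous_on_inverse_arg[OF f])
    then have g_cont: "continuous_on {0<..} g"
      unfolding g_def by (rule continuous_on_minus)
    have g_ineq: "op_fun g (kubo_ando k A B) \<preceq> op_fun g (arithmetic_mean A B)"
      if A: "A \<in> positive_invertible_ops" and B: "B \<in> positive_invertible_ops" for A B :: "'a \<Rightarrow>\<^sub>L 'a"
    proof -
      note inv = positive_invertible_inverse[OF A] positive_invertible_inverse[OF B]
      have piv: "kubo_ando k A B \<in> positive_invertible_ops" "arithmetic_mean A B \<in> positive_invertible_ops"
        using kubo_ando_positive_invertible[OF A B k_cont] k_pos
          arithmetic_mean_positive_invertible[OF A B] by blast+
      have "op_fun f (harmonic_mean (op_inverse A) (op_inverse B)) \<preceq>
          op_fun f (\<sigma> (op_inverse A) (op_inverse B))"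
        by (rule ineq[OF inv])
      moreover have "harmonic_mean (op_inverse A) (op_inverse B) = op_inverse (arithmetic_mean A B)"
        by (simp add: harmonic_mean_eq op_inverse_op_inverse A B)
      moreover have "\<sigma> (op_inverse A) (op_inverse B) = op_inverse (kubo_ando k A B)"
        using kubo_ando_inverse[OF A B h(2,3)] by (simp add: h(6)[OF inv] k_def[abs_def])
      ultimately have "op_fun (\<lambda>t. f (1 / t)) (arithmetic_mean A B) \<preceq>
          op_fun (\<lambda>t. f (1 / t)) (kubo_ando k A B)"
        by (simp add: op_fun_of_inverse piv f)
      then show ?thesis
        unfolding g_def by (simp add: op_fun_uminus_le_iff piv f')
    qed
    have g: "operator_monotone TYPE('a) g"
      using operator_monotone_if_mean_le_arithmetic[OF g_cont operator_monotone_concave[OF dim k] k_cont]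
        k_pos k_sym k_one t0 g_ineq by metis
    show "operator_monotone TYPE('a) f"
      unfolding operator_monotone_def
    proof (intro conjI ballI impI f)
      fix A B :: "'a \<Rightarrow>\<^sub>L 'a"
      assume A: "A \<in> positive_invertible_ops" and B: "B \<in> positive_invertible_ops" and le: "B \<preceq> A"
      have "op_fun g (op_inverse A) \<preceq> op_fun g (op_inverse B)"
        by (intro operator_monotoneD[OF g] positive_invertible_inverse op_inverse_antimono A B le)
      then have "op_fun (\<lambda>t. - f t) A \<preceq> op_fun (\<lambda>t. - f t) B"
        by (simp add: op_fun_of_inverse A B g_cont) (simp add: g_def)
      then show "op_fun f B \<preceq> op_fun f A"
        by (simp add: op_fun_uminus_le_iff A B f)
    qed
  qed
qed

lemma symmetric_mean_positive_invertible:
  assumes "symmetric_mean \<sigma>" "infinite_dimensional TYPE('a::complex_hilbert_space)"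
    and "A \<in> positive_invertible_ops" "B \<in> (positive_invertible_ops :: ('a \<Rightarrow>\<^sub>L 'a) set)"
  shows "\<sigma> A B \<in> positive_invertible_ops"
proof -
  obtain x :: 'a where x: "x \<noteq> 0"
    using infinite_dimensional_orthonormal_pair[OF assms(2)] by (metis cinner_self inner_zero_left of_real_0 zero_neq_one)
  show ?thesis
    using symmetric_mean_function[OF assms(1) x] kubo_ando_positive_invertible[OF assms(3,4)] assms(3,4)
    by metis
qed

theorem proposition4p1:
  fixes f :: "real \<Rightarrow> real"
  assumes "infinite_dimensional TYPE('a::complex_hilbert_space)"
    and "separable_space (euclidean :: 'a topology)"
    and "continuous_on {0<..} f"
  shows
    "(operator_monotone TYPE('a) f \<longleftrightarrow>
       (\<exists>\<sigma> :: 'a binop. symmetric_mean \<sigma> \<and> distinct_means \<sigma> arithmetic_mean \<and>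
          (\<forall>A \<in> positive_invertible_ops. \<forall>B \<in> positive_invertible_ops.
             op_fun f (\<sigma> A B) \<preceq> op_fun f (arithmetic_mean A B))))
     \<and> (operator_monotone TYPE('a) f \<longleftrightarrow>
       (\<exists>\<sigma> :: 'a binop. symmetric_mean \<sigma> \<and> distinct_means \<sigma> harmonic_mean \<and>
          (\<forall>A \<in> positive_invertible_ops. \<forall>B \<in> positive_invertible_ops.
             op_fun f (harmonic_mean A B) \<preceq> op_fun f (\<sigma> A B))))
     \<and> (operator_monotone_decreasing TYPE('a) f \<longleftrightarrow>
       (\<exists>\<sigma> :: 'a binop. symmetric_mean \<sigma> \<and> distinct_means \<sigma> arithmetic_mean \<and>
          (\<forall>A \<in> positive_invertible_ops. \<forall>B \<in> positive_invertible_ops.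
             op_fun f (arithmetic_mean A B) \<preceq> op_fun f (\<sigma> A B))))
     \<and> (operator_monotone_decreasing TYPE('a) f \<longleftrightarrow>
       (\<exists>\<sigma> :: 'a binop. symmetric_mean \<sigma> \<and> distinct_means \<sigma> harmonic_mean \<and>
          (\<forall>A \<in> positive_invertible_ops. \<forall>B \<in> positive_invertible_ops.
             op_fun f (\<sigma> A B) \<preceq> op_fun f (harmonic_mean A B))))"
proof -
  note dim = assms(1) and f = assms(3)
  have f': "continuous_on {0<..} (\<lambda>t. - f t)"
    by (rule continuous_on_minus[OF f])
  have neg: "op_fun (\<lambda>t. - f t) (\<sigma> A B) \<preceq> op_fun (\<lambda>t. - f t) C \<longleftrightarrow> op_fun f C \<preceq> op_fun f (\<sigma> A B)"
      "op_fun (\<lambda>t. - f t) C \<preceq> op_fun (\<lambda>t. - f t) (\<sigma> A B) \<longleftrightarrow> op_fun f (\<sigma> A B) \<preceq> op_fun f C"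
    if "symmetric_mean \<sigma>" "A \<in> positive_invertible_ops" "B \<in> positive_invertible_ops"
      "C \<in> positive_invertible_ops" for \<sigma> :: "'a binop" and A B C
    using that symmetric_mean_positive_invertible[OF that(1) dim] by (simp_all add: op_fun_uminus_le_iff f)
  show ?thesis
    unfolding operator_monotone_decreasing_def operator_monotone_iff_arithmetic[OF dim f, symmetric]
      operator_monotone_iff_harmonic[OF dim f, symmetric]
    using operator_monotone_iff_arithmetic[OF dim f'] operator_monotone_iff_harmonic[OF dim f']
    by (simp add: neg arithmetic_mean_positive_invertible harmonic_mean_positive_invertible cong: conj_cong)
qed

end
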